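(* Let $(n_m)_{m\ge2}$ be a sequence of positive integers and, for each $m\ge2$, let $\varnothing\neq\Lambda_m\subseteq\mathcal M_{m,n_m}$. Then the following are equivalent: (i) $|\Lambda_m|\to\infty$ as $m\to\infty$; (ii) for every $\varepsilon>0$, $\ \mu_{\Lambda_m}\{a\in\mathbb S_{\Lambda_m}: R_m(a)>\varepsilon\}\to0$ as $m\to\infty$.
   Context: For $m,n\in\mathbb N$ let $\mathcal M_{m,n}:=\{\alpha\in\mathbb N_0^n: |\alpha|=m\}$ and $q_m:=2m/(m+1)$. For nonempty $\Lambda\subseteq\mathcal M_{m,n}$ and $a=(a_\alpha)_{\alpha\in\Lambda}\in\mathbb C^\Lambda$ put $\|a\|_p:=(\sum_{\alpha\in\Lambda}|a_\alpha|^p)^{1/p}$, $P_a(z):=\sum_{\alpha\in\Lambda}a_\alpha z^\alpha$ for $z\in\mathbb C^n$, and $\|P_a\|_\infty:=\sup|P_a(z)|$ over the unit polydisc (equivalently over $\{z\in\mathbb C^n:|z_j|=1\ \forall j\}$). $R_m(a):=\|a\|_{q_m}/\|P_a\|_\infty$ for $a\neq0$ and $R_m(0):=0$. $\mathbb S_\Lambda:=\{a\in\mathbb C^\Lambda:\|a\|_2=1\}$ and $\mu_\Lambda$ is normalized (total mass one) Euclidean surface measure on $\mathbb S_\Lambda$, where $\mathbb C^\Lambda\simeq\mathbb R^{2|\Lambda|}$. *)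

theory Defs
  imports "HOL-Probability.Probability"
begin

section \<open>Homogeneous polynomials and the Bohnenblust--Hille quotient\<close>

definition multiindices :: "nat \<Rightarrow> nat \<Rightarrow> (nat \<Rightarrow> nat) set" where
  "multiindices m n = {\<alpha> \<in> {..<n} \<rightarrow>\<^sub>E UNIV. (\<Sum>j<n. \<alpha> j) = m}"

definition bh_exponent :: "nat \<Rightarrow> real" where
  "bh_exponent m = 2 * real m / (real m + 1)"

definition lp_norm :: "real \<Rightarrow> 'i set \<Rightarrow> ('i \<Rightarrow> complex) \<Rightarrow> real" where
  "lp_norm p \<Lambda> a = (\<Sum>\<alpha>\<in>\<Lambda>. cmod (a \<alpha>) powr p) powr (1 / p)"

definition hpoly :: "nat \<Rightarrow> (nat \<Rightarrow> nat) set \<Rightarrow> ((nat \<Rightarrow> nat) \<Rightarrow> complex) \<Rightarrow> (nat \<Rightarrow> complex) \<Rightarrow> complex" where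
  "hpoly n \<Lambda> a z = (\<Sum>\<alpha>\<in>\<Lambda>. a \<alpha> * (\<Prod>j<n. z j ^ \<alpha> j))"

definition polydisc :: "nat \<Rightarrow> (nat \<Rightarrow> complex) set" where
  "polydisc n = {..<n} \<rightarrow>\<^sub>E ball 0 1"

definition hpoly_norm :: "nat \<Rightarrow> (nat \<Rightarrow> nat) set \<Rightarrow> ((nat \<Rightarrow> nat) \<Rightarrow> complex) \<Rightarrow> real" where
  "hpoly_norm n \<Lambda> a = (SUP z\<in>polydisc n. cmod (hpoly n \<Lambda> a z))"

definition bh_quotient :: "nat \<Rightarrow> nat \<Rightarrow> (nat \<Rightarrow> nat) set \<Rightarrow> ((nat \<Rightarrow> nat) \<Rightarrow> complex) \<Rightarrow> real" where
  "bh_quotient m n \<Lambda> a =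
     (if \<forall>\<alpha>\<in>\<Lambda>. a \<alpha> = 0 then 0 else lp_norm (bh_exponent m) \<Lambda> a / hpoly_norm n \<Lambda> a)"


section \<open>Surface measure on the unit sphere of a finite-dimensional complex space\<close>

text \<open>
  For a finite index set \<open>\<Lambda>\<close>, the space of complex families indexed by \<open>\<Lambda>\<close> is
  \<open>\<Lambda> \<rightarrow>\<^sub>E UNIV\<close>. Lebesgue measure on it, viewed as a real space of dimension
  \<open>2 * card \<Lambda>\<close>, is the product of the planar Lebesgue measures.
\<close>

definition lebesgue_family :: "'i set \<Rightarrow> ('i \<Rightarrow> complex) measure" where
  "lebesgue_family \<Lambda> = (\<Pi>\<^sub>M \<alpha>\<in>\<Lambda>. lborel)"

definition unit_sphere :: "'i set \<Rightarrow> ('i \<Rightarrow> complex) set" where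
  "unit_sphere \<Lambda> = {a \<in> \<Lambda> \<rightarrow>\<^sub>E UNIV. lp_norm 2 \<Lambda> a = 1}"

definition radial_cone :: "'i set \<Rightarrow> ('i \<Rightarrow> complex) set \<Rightarrow> ('i \<Rightarrow> complex) set" where
  "radial_cone \<Lambda> E = {(\<lambda>\<alpha>\<in>\<Lambda>. of_real r * a \<alpha>) | r a. 0 < r \<and> r \<le> 1 \<and> a \<in> E}"

text \<open>
  Euclidean surface measure in the standard construction from polar coordinates: a Borel set
  \<open>E\<close> of the unit sphere in real dimension \<open>d\<close> has area \<open>d\<close> times the Lebesgue measure of
  the cone over \<open>E\<close>. Here \<open>d = 2 * card \<Lambda>\<close>.
\<close>

definition surface_measure :: "'i set \<Rightarrow> ('i \<Rightarrow> complex) measure" where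
  "surface_measure \<Lambda> =
     measure_of (unit_sphere \<Lambda>) (sets (restrict_space (lebesgue_family \<Lambda>) (unit_sphere \<Lambda>)))
       (\<lambda>E. of_nat (2 * card \<Lambda>) * emeasure (lebesgue_family \<Lambda>) (radial_cone \<Lambda> E))"

definition sphere_prob :: "'i set \<Rightarrow> ('i \<Rightarrow> complex) measure" where
  "sphere_prob \<Lambda> = uniform_measure (surface_measure \<Lambda>) (unit_sphere \<Lambda>)"


subsection \<open>Well-definedness\<close>

lemma sets_lebesgue_family: "sets (lebesgue_family \<Lambda>) = sets (\<Pi>\<^sub>M \<alpha>\<in>\<Lambda>. borel)"
  unfolding lebesgue_family_def by (intro sets_PiM_cong) auto

lemma space_lebesgue_family: "space (lebesgue_family \<Lambda>) = (\<Lambda> \<rightarrow>\<^sub>E UNIV)"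
  by (simp add: lebesgue_family_def space_PiM)

lemma lp_norm_2_nonneg: "lp_norm 2 \<Lambda> a \<ge> 0"
  by (simp add: lp_norm_def)

lemma lp_norm_2_scale:
  assumes "r \<ge> 0"
  shows "lp_norm 2 \<Lambda> (\<lambda>\<alpha>\<in>\<Lambda>. complex_of_real r * a \<alpha>) = r * lp_norm 2 \<Lambda> a"
proof -
  have "(\<Sum>\<alpha>\<in>\<Lambda>. cmod ((\<lambda>\<alpha>\<in>\<Lambda>. complex_of_real r * a \<alpha>) \<alpha>) powr 2)
      = r powr 2 * (\<Sum>\<alpha>\<in>\<Lambda>. cmod (a \<alpha>) powr 2)"
    unfolding sum_distrib_left
    by (intro sum.cong) (use assms in \<open>auto simp: norm_mult powr_mult\<close>)
  then show ?thesis using assms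
    by (simp add: lp_norm_def powr_mult powr_powr sum_nonneg del: powr_numeral)
qed

lemma measurable_lp_norm_2 [measurable]:
  "lp_norm 2 \<Lambda> \<in> borel_measurable (lebesgue_family \<Lambda>)"
proof -
  have "(\<lambda>a. (\<Sum>\<alpha>\<in>\<Lambda>. cmod (a \<alpha>) powr 2) powr (1 / 2)) \<in> borel_measurable (lebesgue_family \<Lambda>)"
    unfolding lebesgue_family_def by measurable
  then show ?thesis by (simp add: lp_norm_def [abs_def])
qed

definition radial :: "'i set \<Rightarrow> ('i \<Rightarrow> complex) \<Rightarrow> 'i \<Rightarrow> complex" where
  "radial \<Lambda> a = (\<lambda>\<alpha>\<in>\<Lambda>. complex_of_real (inverse (lp_norm 2 \<Lambda> a)) * a \<alpha>)"

lemma measurable_radial [measurable]: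
  "radial \<Lambda> \<in> measurable (lebesgue_family \<Lambda>) (lebesgue_family \<Lambda>)"
proof -
  have comp: "(\<lambda>a. a \<alpha>) \<in> borel_measurable (lebesgue_family \<Lambda>)" if "\<alpha> \<in> \<Lambda>" for \<alpha>
    using measurable_component_singleton [OF that, of "\<lambda>_. lborel"]
    unfolding lebesgue_family_def by simp
  have "(\<lambda>a. \<lambda>\<alpha>\<in>\<Lambda>. complex_of_real (inverse (lp_norm 2 \<Lambda> a)) * a \<alpha>)
      \<in> measurable (lebesgue_family \<Lambda>) (\<Pi>\<^sub>M \<alpha>\<in>\<Lambda>. lborel)"
  proof (rule measurable_restrict)
    fix \<alpha> assume "\<alpha> \<in> \<Lambda>"
    note [measurable] = comp [OF this]
    show "(\<lambda>a. complex_of_real (inverse (lp_norm 2 \<Lambda> a)) * a \<alpha>) \<in> measurable (lebesgue_family \<Lambda>) lborel"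
      by measurable
  qed
  then show ?thesis
    unfolding radial_def [abs_def] lebesgue_family_def .
qed

lemma radial_cone_eq:
  assumes "E \<subseteq> unit_sphere \<Lambda>"
  shows "radial_cone \<Lambda> E = {a \<in> \<Lambda> \<rightarrow>\<^sub>E UNIV. 0 < lp_norm 2 \<Lambda> a \<and> lp_norm 2 \<Lambda> a \<le> 1 \<and> radial \<Lambda> a \<in> E}"
proof (intro set_eqI iffI)
  fix x assume "x \<in> radial_cone \<Lambda> E"
  then obtain r a where x: "x = (\<lambda>\<alpha>\<in>\<Lambda>. complex_of_real r * a \<alpha>)" and r: "0 < r" "r \<le> 1" and a: "a \<in> E"
    by (auto simp: radial_cone_def)
  have "a \<in> \<Lambda> \<rightarrow>\<^sub>E UNIV" and na: "lp_norm 2 \<Lambda> a = 1"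
    using a assms by (auto simp: unit_sphere_def)
  have nx: "lp_norm 2 \<Lambda> x = r"
    using r na by (simp add: x lp_norm_2_scale)
  have "radial \<Lambda> x = a"
  proof
    fix \<alpha>
    show "radial \<Lambda> x \<alpha> = a \<alpha>"
    proof (cases "\<alpha> \<in> \<Lambda>")
      case True
      then have "radial \<Lambda> x \<alpha> = complex_of_real (inverse r) * (complex_of_real r * a \<alpha>)"
        unfolding radial_def nx by (simp add: x)
      also have "\<dots> = a \<alpha>" using r by simp
      finally show ?thesis .
    next
      case False
      then show ?thesis using \<open>a \<in> \<Lambda> \<rightarrow>\<^sub>E UNIV\<close> by (auto simp: radial_def PiE_def extensional_def)
    qed
  qed
  then show "x \<in> {a \<in> \<Lambda> \<rightarrow>\<^sub>E UNIV. 0 < lp_norm 2 \<Lambda> a \<and> lp_norm 2 \<Lambda> a \<le> 1 \<and> radial \<Lambda> a \<in> E}"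
    using nx r a by (auto simp: x)
next
  fix x assume x: "x \<in> {a \<in> \<Lambda> \<rightarrow>\<^sub>E UNIV. 0 < lp_norm 2 \<Lambda> a \<and> lp_norm 2 \<Lambda> a \<le> 1 \<and> radial \<Lambda> a \<in> E}"
  have "x = (\<lambda>\<alpha>\<in>\<Lambda>. complex_of_real (lp_norm 2 \<Lambda> x) * radial \<Lambda> x \<alpha>)"
  proof
    fix \<alpha>
    show "x \<alpha> = (\<lambda>\<alpha>\<in>\<Lambda>. complex_of_real (lp_norm 2 \<Lambda> x) * radial \<Lambda> x \<alpha>) \<alpha>"
      using x by (cases "\<alpha> \<in> \<Lambda>") (auto simp: radial_def PiE_def extensional_def)
  qed
  then show "x \<in> radial_cone \<Lambda> E"
    unfolding radial_cone_def using x by blast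
qed

lemma unit_sphere_in_sets: "unit_sphere \<Lambda> \<in> sets (lebesgue_family \<Lambda>)"
proof -
  have "{a \<in> space (lebesgue_family \<Lambda>). lp_norm 2 \<Lambda> a = 1} \<in> sets (lebesgue_family \<Lambda>)"
    by measurable
  then show ?thesis by (simp add: unit_sphere_def space_lebesgue_family)
qed

lemma sets_restrict_sphere:
  "sets (restrict_space (lebesgue_family \<Lambda>) (unit_sphere \<Lambda>)) =
     {E. E \<subseteq> unit_sphere \<Lambda> \<and> E \<in> sets (lebesgue_family \<Lambda>)}"
  using unit_sphere_in_sets [of \<Lambda>] by (auto simp: sets_restrict_space)

lemma radial_cone_in_sets:
  assumes "E \<subseteq> unit_sphere \<Lambda>" "E \<in> sets (lebesgue_family \<Lambda>)"
  shows "radial_cone \<Lambda> E \<in> sets (lebesgue_family \<Lambda>)"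
proof -
  note [measurable] = assms(2)
  have "{a \<in> space (lebesgue_family \<Lambda>). 0 < lp_norm 2 \<Lambda> a \<and> lp_norm 2 \<Lambda> a \<le> 1 \<and> radial \<Lambda> a \<in> E}
      \<in> sets (lebesgue_family \<Lambda>)"
    by measurable
  then show ?thesis by (simp add: radial_cone_eq [OF assms(1)] space_lebesgue_family)
qed

lemma space_surface_measure: "space (surface_measure \<Lambda>) = unit_sphere \<Lambda>"
  unfolding surface_measure_def
  by (rule space_measure_of) (auto simp: sets_restrict_sphere)

lemma sets_surface_measure:
  "sets (surface_measure \<Lambda>) = {E. E \<subseteq> unit_sphere \<Lambda> \<and> E \<in> sets (lebesgue_family \<Lambda>)}"
proof -
  have "space (restrict_space (lebesgue_family \<Lambda>) (unit_sphere \<Lambda>)) = unit_sphere \<Lambda>"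
    by (auto simp: space_restrict_space unit_sphere_def space_lebesgue_family)
  then have "sigma_sets (unit_sphere \<Lambda>) (sets (restrict_space (lebesgue_family \<Lambda>) (unit_sphere \<Lambda>)))
      = sets (restrict_space (lebesgue_family \<Lambda>) (unit_sphere \<Lambda>))"
    by (metis sets.sigma_sets_eq)
  then show ?thesis
    unfolding surface_measure_def
    by (subst sets_measure_of) (auto simp: sets_restrict_sphere)
qed

lemma emeasure_surface_measure:
  assumes "E \<subseteq> unit_sphere \<Lambda>" "E \<in> sets (lebesgue_family \<Lambda>)"
  shows "emeasure (surface_measure \<Lambda>) E
       = of_nat (2 * card \<Lambda>) * emeasure (lebesgue_family \<Lambda>) (radial_cone \<Lambda> E)"
proof (rule emeasure_measure_of [OF surface_measure_def])
  show "sets (restrict_space (lebesgue_family \<Lambda>) (unit_sphere \<Lambda>)) \<subseteq> Pow (unit_sphere \<Lambda>)"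
    by (auto simp: sets_restrict_sphere)
  show "E \<in> sets (surface_measure \<Lambda>)"
    using assms by (simp add: sets_surface_measure)
  let ?\<mu> = "\<lambda>E. of_nat (2 * card \<Lambda>) * emeasure (lebesgue_family \<Lambda>) (radial_cone \<Lambda> E)"
  show "positive (sets (surface_measure \<Lambda>)) ?\<mu>"
    by (simp add: positive_def radial_cone_def)
  show "countably_additive (sets (surface_measure \<Lambda>)) ?\<mu>"
  proof (rule countably_additiveI)
    fix A :: "nat \<Rightarrow> ('a \<Rightarrow> complex) set"
    assume A: "range A \<subseteq> sets (surface_measure \<Lambda>)" and disj: "disjoint_family A"
    then have sub: "A i \<subseteq> unit_sphere \<Lambda>" and meas: "A i \<in> sets (lebesgue_family \<Lambda>)" for i
      by (auto simp: sets_surface_measure)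
    have "disjoint_family (\<lambda>i. radial_cone \<Lambda> (A i))"
      using disj by (auto simp: disjoint_family_on_def radial_cone_eq [OF sub])
    then have "(\<Sum>i. emeasure (lebesgue_family \<Lambda>) (radial_cone \<Lambda> (A i)))
        = emeasure (lebesgue_family \<Lambda>) (\<Union>i. radial_cone \<Lambda> (A i))"
      by (intro suminf_emeasure) (use sub meas in \<open>auto intro!: radial_cone_in_sets\<close>)
    also have "(\<Union>i. radial_cone \<Lambda> (A i)) = radial_cone \<Lambda> (\<Union>i. A i)"
      by (auto simp: radial_cone_def)
    finally show "(\<Sum>i. ?\<mu> (A i)) = ?\<mu> (\<Union>i. A i)"
      by simp
  qed
qed

lemma prob_space_sphere_prob:
  assumes "finite \<Lambda>" "\<Lambda> \<noteq> {}"
  shows "prob_space (sphere_prob \<Lambda>)"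
proof -
  interpret product_sigma_finite "\<lambda>_ :: 'a. lborel :: complex measure"
    by (simp add: product_sigma_finite_def lborel.sigma_finite_measure_axioms)
  define N where "N = real (card \<Lambda>)"
  have N: "N \<ge> 1" using assms by (simp add: N_def Suc_le_eq card_gt_0_iff)
  have sq: "lp_norm 2 \<Lambda> a = sqrt (\<Sum>\<alpha>\<in>\<Lambda>. (cmod (a \<alpha>))\<^sup>2)" for a
    by (simp add: lp_norm_def powr_half_sqrt sum_nonneg)
  have rad: "radial \<Lambda> a \<in> unit_sphere \<Lambda>" if "0 < lp_norm 2 \<Lambda> a" for a
    using lp_norm_2_scale [of "inverse (lp_norm 2 \<Lambda> a)" \<Lambda> a] that
    by (simp add: unit_sphere_def radial_def [abs_def])
  have cone: "radial_cone \<Lambda> (unit_sphere \<Lambda>) = {a \<in> \<Lambda> \<rightarrow>\<^sub>E UNIV. 0 < lp_norm 2 \<Lambda> a \<and> lp_norm 2 \<Lambda> a \<le> 1}"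
    using rad by (auto simp: radial_cone_eq)
  have "(\<Pi>\<^sub>E \<alpha>\<in>\<Lambda>. ball 0 (1 / N) - {0}) \<subseteq> radial_cone \<Lambda> (unit_sphere \<Lambda>)"
  proof
    fix a assume a: "a \<in> (\<Pi>\<^sub>E \<alpha>\<in>\<Lambda>. ball (0 :: complex) (1 / N) - {0})"
    have "(\<Sum>\<alpha>\<in>\<Lambda>. (cmod (a \<alpha>))\<^sup>2) \<le> (\<Sum>\<alpha>\<in>\<Lambda>. (1 / N)\<^sup>2)"
      by (intro sum_mono power_mono) (use a in \<open>auto simp: PiE_iff less_imp_le\<close>)
    also have "\<dots> = 1 / N" using N by (simp add: N_def power2_eq_square)
    also have "\<dots> \<le> 1" using N by simp
    finally have "lp_norm 2 \<Lambda> a \<le> 1" by (simp add: sq)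
    moreover have "(\<Sum>\<alpha>\<in>\<Lambda>. (cmod (a \<alpha>))\<^sup>2) > 0"
      by (intro sum_pos) (use a assms in \<open>auto simp: PiE_iff\<close>)
    ultimately show "a \<in> radial_cone \<Lambda> (unit_sphere \<Lambda>)"
      using a by (auto simp: cone sq PiE_iff)
  qed
  then have "emeasure (lebesgue_family \<Lambda>) (\<Pi>\<^sub>E \<alpha>\<in>\<Lambda>. ball 0 (1 / N) - {0})
      \<le> emeasure (lebesgue_family \<Lambda>) (radial_cone \<Lambda> (unit_sphere \<Lambda>))"
    by (intro emeasure_mono radial_cone_in_sets unit_sphere_in_sets) auto
  moreover have "emeasure (lebesgue_family \<Lambda>) (\<Pi>\<^sub>E \<alpha>\<in>\<Lambda>. ball 0 (1 / N) - {0})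
      = (\<Prod>\<alpha>\<in>\<Lambda>. emeasure lborel (ball (0 :: complex) (1 / N) - {0}))"
    unfolding lebesgue_family_def using assms by (intro emeasure_PiM) auto
  moreover have "emeasure lborel (ball (0 :: complex) (1 / N) - {0}) \<noteq> 0"
  proof
    assume "emeasure lborel (ball (0 :: complex) (1 / N) - {0}) = 0"
    then have "ball (0 :: complex) (1 / N) - {0} \<in> null_sets lebesgue"
      by (intro null_sets_completionI) (auto simp: null_sets_def)
    then have "negligible (ball (0 :: complex) (1 / N) - {0})"
      by (simp only: negligible_iff_null_sets)
    moreover have "open (ball (0 :: complex) (1 / N) - {0})"
      by (intro open_Diff) auto
    moreover have "complex_of_real (1 / (2 * N)) \<in> ball (0 :: complex) (1 / N) - {0}"
      using N by (simp add: norm_divide field_simps)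
    ultimately show False
      using open_not_negligible by blast
  qed
  ultimately have pos: "emeasure (lebesgue_family \<Lambda>) (radial_cone \<Lambda> (unit_sphere \<Lambda>)) \<noteq> 0"
    using assms by (auto simp: prod_zero_iff)
  have "radial_cone \<Lambda> (unit_sphere \<Lambda>) \<subseteq> (\<Pi>\<^sub>E \<alpha>\<in>\<Lambda>. cball 0 1)"
  proof
    fix a assume a: "a \<in> radial_cone \<Lambda> (unit_sphere \<Lambda>)"
    have "cmod (a \<alpha>) \<le> 1" if "\<alpha> \<in> \<Lambda>" for \<alpha>
    proof -
      have "(cmod (a \<alpha>))\<^sup>2 \<le> (\<Sum>\<alpha>\<in>\<Lambda>. (cmod (a \<alpha>))\<^sup>2)"
        using that assms by (intro member_le_sum) auto
      also have "\<dots> \<le> 1" using a by (simp add: cone sq)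
      finally show ?thesis by (simp add: power_le_one_iff)
    qed
    then show "a \<in> (\<Pi>\<^sub>E \<alpha>\<in>\<Lambda>. cball 0 1)"
      using a by (auto simp: cone PiE_iff)
  qed
  then have "emeasure (lebesgue_family \<Lambda>) (radial_cone \<Lambda> (unit_sphere \<Lambda>))
      \<le> emeasure (lebesgue_family \<Lambda>) (\<Pi>\<^sub>E \<alpha>\<in>\<Lambda>. cball 0 1)"
    using assms unfolding lebesgue_family_def by (intro emeasure_mono) (auto intro!: sets_PiM_I_finite)
  also have "\<dots> = (\<Prod>\<alpha>\<in>\<Lambda>. emeasure lborel (cball (0 :: complex) 1))"
    unfolding lebesgue_family_def using assms by (intro emeasure_PiM) auto
  also have "\<dots> < \<infinity>"
    using emeasure_lborel_cball_finite [of "0 :: complex" 1]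
    by (auto simp: power_eq_top_ennreal less_top [symmetric])
  finally have fin: "emeasure (lebesgue_family \<Lambda>) (radial_cone \<Lambda> (unit_sphere \<Lambda>)) < \<infinity>" .
  show ?thesis
    unfolding sphere_prob_def
    by (rule prob_space_uniform_measure)
       (use pos fin assms in \<open>auto simp: emeasure_surface_measure unit_sphere_in_sets ennreal_mult_eq_top_iff\<close>)
qed

end

theory Submission
  imports Defs
begin

text \<open>
  If \<open>|\<Lambda>\<^sub>m|\<close> stays bounded by \<open>K\<close> along a subsequence, then \<open>R\<^sub>m \<ge> 1 / K\<close> on the whole sphere there.

  Conversely let \<open>N = |\<Lambda>\<^sub>m|\<close> and \<open>T = N powr (1 / m)\<close>. On the sphere, Hoelder's inequality bounds the numerator
  of \<open>R\<^sub>m\<close> by \<open>sqrt T\<close>, so the sup norm has to exceed \<open>sqrt T / \<epsilon>\<close> with high probability. Normalized surface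
  measure is the image of a Gaussian measure under \<open>x \<mapsto> x / |x|\<close>, and for Gaussian coefficients \<open>x\<close> the
  average \<open>S\<close> of \<open>cosh (\<lambda> Re P\<^sub>x(z))\<close> over all \<open>z\<close> with coordinates in the \<open>L\<close>-th roots of unity has explicit
  first and second moments. With \<open>\<lambda>\<^sup>2 = A T / N\<close>, the relative variance of \<open>S\<close> is governed by
  even moments of \<open>z \<mapsto> \<Sum>\<alpha>\<in>\<Lambda>. c\<^sub>\<alpha> z\<^sup>\<alpha>\<close> with unimodular \<open>c\<^sub>\<alpha>\<close>; the moment of order \<open>2 k\<close> is
  at most \<open>k ^ (m k) N ^ k\<close> by counting decompositions of multi-indices. Hence the variance tends to zero,
  \<open>S\<close> is at least half its mean \<open>exp (A T / 4)\<close>, and this forces the sup norm to be large.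
\<close>

section \<open>Complex Gaussian families\<close>

text \<open>Under the identification of the complex plane with two real coordinates, the integrand
  is \<open>2 * pi * \<sigma>\<^sup>2\<close> times a product of two one-dimensional normal
  densities, each of total mass 1.\<close>

lemma nn_integral_complex_gaussian:
  fixes c :: complex
  assumes "\<sigma> > 0"
  shows "(\<integral>\<^sup>+z. ennreal (exp (- (cmod (z - c))\<^sup>2 / (2 * \<sigma>\<^sup>2))) \<partial>lborel) = ennreal (2 * pi * \<sigma>\<^sup>2)"
proof -
  have "exp (- (cmod (z - c))\<^sup>2 / (2 * \<sigma>\<^sup>2))
      = 2 * pi * \<sigma>\<^sup>2 * (\<Prod>b\<in>Basis. normal_density (c \<bullet> b) \<sigma> (z \<bullet> b))" for z
  proof -
    have "- (cmod (z - c))\<^sup>2 / (2 * \<sigma>\<^sup>2) = - (Re z - Re c)\<^sup>2 / (2 * \<sigma>\<^sup>2) + - (Im z - Im c)\<^sup>2 / (2 * \<sigma>\<^sup>2)"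
      unfolding cmod_power2 by (simp add: diff_divide_distrib)
    then show ?thesis
      using assms by (simp only: exp_add) (simp add: Basis_complex_def normal_density_def)
  qed
  then have "(\<integral>\<^sup>+z. ennreal (exp (- (cmod (z - c))\<^sup>2 / (2 * \<sigma>\<^sup>2))) \<partial>lborel)
      = (\<integral>\<^sup>+z. ennreal (2 * pi * \<sigma>\<^sup>2) * (\<Prod>b\<in>Basis. ennreal (normal_density (c \<bullet> b) \<sigma> (z \<bullet> b))) \<partial>lborel)"
    by (simp add: ennreal_mult' prod_ennreal)
  also have "\<dots> = ennreal (2 * pi * \<sigma>\<^sup>2) * (\<integral>\<^sup>+z. (\<Prod>b\<in>Basis. ennreal (normal_density (c \<bullet> b) \<sigma> (z \<bullet> b))) \<partial>lborel)"
    by (intro nn_integral_cmult) measurable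
  also have "(\<integral>\<^sup>+z. (\<Prod>b\<in>Basis. ennreal (normal_density (c \<bullet> b) \<sigma> (z \<bullet> b))) \<partial>lborel)
      = (\<Prod>b\<in>(Basis :: complex set). \<integral>\<^sup>+x. ennreal (normal_density (c \<bullet> b) \<sigma> x) \<partial>lborel)"
    by (intro nn_integral_lborel_prod) auto
  also have "\<dots> = 1"
    using assms by (simp add: nn_integral_eq_integral)
  finally show ?thesis by simp
qed

text \<open>Independent standard complex Gaussians: each coordinate has density
  \<open>exp (- (cmod z)\<^sup>2) / pi\<close>, so its absolute value squared has mean 1. A single
  density against Lebesgue measure, depending only on the Euclidean norm, makes the rotation
  invariance used for cones visible.\<close>

definition gaussian_family :: "'i set \<Rightarrow> ('i \<Rightarrow> complex) measure" where
  "gaussian_family \<Lambda> = density (lebesgue_family \<Lambda>) (\<lambda>x. ennreal (exp (- (\<Sum>\<alpha>\<in>\<Lambda>. (cmod (x \<alpha>))\<^sup>2)) / pi ^ card \<Lambda>))"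

lemma measurable_family_component [measurable]:
  "\<alpha> \<in> \<Lambda> \<Longrightarrow> (\<lambda>x. x \<alpha>) \<in> borel_measurable (lebesgue_family \<Lambda>)"
  using measurable_component_singleton [of \<alpha> \<Lambda> "\<lambda>_. lborel :: complex measure"]
  unfolding lebesgue_family_def by simp

lemma sets_gaussian_family [simp, measurable_cong]: "sets (gaussian_family \<Lambda>) = sets (lebesgue_family \<Lambda>)"
  by (simp add: gaussian_family_def)

lemma space_gaussian_family [simp]: "space (gaussian_family \<Lambda>) = \<Lambda> \<rightarrow>\<^sub>E UNIV"
  by (simp add: gaussian_family_def space_lebesgue_family)

text \<open>The density is itself a product over coordinates, so Tonelli factorizes the integral.
  The exponential moments below thereby reduce to planar integrals.\<close>

lemma nn_integral_gaussian_family_prod: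
  assumes "finite \<Lambda>" and [measurable]: "\<And>\<alpha>. \<alpha> \<in> \<Lambda> \<Longrightarrow> f \<alpha> \<in> borel_measurable borel"
    and "\<And>\<alpha> z. \<alpha> \<in> \<Lambda> \<Longrightarrow> 0 \<le> f \<alpha> z"
  shows "(\<integral>\<^sup>+x. ennreal (\<Prod>\<alpha>\<in>\<Lambda>. f \<alpha> (x \<alpha>)) \<partial>gaussian_family \<Lambda>)
    = (\<Prod>\<alpha>\<in>\<Lambda>. \<integral>\<^sup>+z. ennreal (exp (- (cmod z)\<^sup>2) * f \<alpha> z / pi) \<partial>lborel)"
proof -
  interpret product_sigma_finite "\<lambda>_ :: 'a. lborel :: complex measure"
    by (simp add: product_sigma_finite_def lborel.sigma_finite_measure_axioms)
  have "(\<integral>\<^sup>+x. ennreal (\<Prod>\<alpha>\<in>\<Lambda>. f \<alpha> (x \<alpha>)) \<partial>gaussian_family \<Lambda>)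
      = (\<integral>\<^sup>+x. ennreal (exp (- (\<Sum>\<alpha>\<in>\<Lambda>. (cmod (x \<alpha>))\<^sup>2)) / pi ^ card \<Lambda>) * ennreal (\<Prod>\<alpha>\<in>\<Lambda>. f \<alpha> (x \<alpha>)) \<partial>lebesgue_family \<Lambda>)"
    unfolding gaussian_family_def by (intro nn_integral_density) measurable
  also have "\<dots> = (\<integral>\<^sup>+x. (\<Prod>\<alpha>\<in>\<Lambda>. ennreal (exp (- (cmod (x \<alpha>))\<^sup>2) * f \<alpha> (x \<alpha>) / pi)) \<partial>lebesgue_family \<Lambda>)"
    using assms
    by (intro nn_integral_cong)
       (simp add: prod_ennreal ennreal_mult' [symmetric] prod.distrib prod_dividef exp_sum sum_negf [symmetric]
         prod_nonneg field_simps)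
  also have "\<dots> = (\<Prod>\<alpha>\<in>\<Lambda>. \<integral>\<^sup>+z. ennreal (exp (- (cmod z)\<^sup>2) * f \<alpha> z / pi) \<partial>lborel)"
    unfolding lebesgue_family_def using assms(1) by (intro product_nn_integral_prod) auto
  finally show ?thesis .
qed

text \<open>Completing the square in each coordinate turns the integrand into a shifted Gaussian and
  leaves the factor \<open>exp ((cmod c)\<^sup>2 / 4)\<close>.\<close>

lemma nn_integral_gaussian_exp_linear:
  assumes "finite \<Lambda>"
  shows "(\<integral>\<^sup>+x. ennreal (exp (Re (\<Sum>\<alpha>\<in>\<Lambda>. w \<alpha> * x \<alpha>))) \<partial>gaussian_family \<Lambda>)
    = ennreal (exp ((\<Sum>\<alpha>\<in>\<Lambda>. (cmod (w \<alpha>))\<^sup>2) / 4))"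
proof -
  have one: "(\<integral>\<^sup>+z. ennreal (exp (- (cmod z)\<^sup>2) * exp (Re (c * z)) / pi) \<partial>lborel) = ennreal (exp ((cmod c)\<^sup>2 / 4))" for c
  proof -
    have "- (cmod z)\<^sup>2 + Re (c * z) = (cmod c)\<^sup>2 / 4 - (cmod (z - cnj c / 2))\<^sup>2" for z
      unfolding cmod_power2 by (simp add: power2_eq_square field_simps)
    \<comment> \<open>The choice \<open>\<sigma> = 1 / sqrt 2\<close> makes
      \<open>2 * \<sigma>\<^sup>2 = 1\<close>, which matches the planar integral computed
      above.\<close>
    then have "(\<integral>\<^sup>+z. ennreal (exp (- (cmod z)\<^sup>2) * exp (Re (c * z)) / pi) \<partial>lborel)
        = (\<integral>\<^sup>+z. ennreal (exp ((cmod c)\<^sup>2 / 4) / pi) * ennreal (exp (- (cmod (z - cnj c / 2))\<^sup>2 / (2 * (1 / sqrt 2)\<^sup>2))) \<partial>lborel)"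
      by (intro nn_integral_cong)
         (simp add: exp_add [symmetric] ennreal_mult' [symmetric] power_divide exp_diff exp_minus field_simps del: ennreal_mult')
    also have "\<dots> = ennreal (exp ((cmod c)\<^sup>2 / 4) / pi) * ennreal (2 * pi * (1 / sqrt 2)\<^sup>2)"
      by (subst nn_integral_cmult) (simp, subst nn_integral_complex_gaussian, simp_all)
    also have "\<dots> = ennreal (exp ((cmod c)\<^sup>2 / 4))"
      by (simp add: ennreal_mult' [symmetric] power_divide)
    finally show ?thesis .
  qed
  have "(\<integral>\<^sup>+x. ennreal (exp (Re (\<Sum>\<alpha>\<in>\<Lambda>. w \<alpha> * x \<alpha>))) \<partial>gaussian_family \<Lambda>)
      = (\<integral>\<^sup>+x. ennreal (\<Prod>\<alpha>\<in>\<Lambda>. exp (Re (w \<alpha> * x \<alpha>))) \<partial>gaussian_family \<Lambda>)"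
    using assms by (simp add: exp_sum)
  also have "\<dots> = (\<Prod>\<alpha>\<in>\<Lambda>. ennreal (exp ((cmod (w \<alpha>))\<^sup>2 / 4)))"
    using assms by (subst nn_integral_gaussian_family_prod) (auto simp del: times_complex.sel simp: one)
  also have "\<dots> = ennreal (exp ((\<Sum>\<alpha>\<in>\<Lambda>. (cmod (w \<alpha>))\<^sup>2) / 4))"
    using assms by (simp add: prod_ennreal exp_sum sum_divide_distrib)
  finally show ?thesis .
qed

text \<open>The total mass is the exponential moment of the zero linear form.\<close>

lemma prob_space_gaussian_family:
  assumes "finite \<Lambda>"
  shows "prob_space (gaussian_family \<Lambda>)"
proof
  have "emeasure (gaussian_family \<Lambda>) (space (gaussian_family \<Lambda>)) = (\<integral>\<^sup>+x. 1 \<partial>gaussian_family \<Lambda>)"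
    by simp
  also have "\<dots> = 1"
    using nn_integral_gaussian_exp_linear [OF assms, of "\<lambda>_. 0"] by simp
  finally show "emeasure (gaussian_family \<Lambda>) (space (gaussian_family \<Lambda>)) = 1" .
qed

lemma gaussian_exp_linear:
  assumes "finite \<Lambda>"
  shows "integrable (gaussian_family \<Lambda>) (\<lambda>x. exp (Re (\<Sum>\<alpha>\<in>\<Lambda>. w \<alpha> * x \<alpha>)))" (is ?I)
    and "(\<integral>x. exp (Re (\<Sum>\<alpha>\<in>\<Lambda>. w \<alpha> * x \<alpha>)) \<partial>gaussian_family \<Lambda>) = exp ((\<Sum>\<alpha>\<in>\<Lambda>. (cmod (w \<alpha>))\<^sup>2) / 4)"
proof -
  have "has_bochner_integral (gaussian_family \<Lambda>) (\<lambda>x. exp (Re (\<Sum>\<alpha>\<in>\<Lambda>. w \<alpha> * x \<alpha>)))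
      (exp ((\<Sum>\<alpha>\<in>\<Lambda>. (cmod (w \<alpha>))\<^sup>2) / 4))"
    by (rule has_bochner_integral_nn_integral)
       (use nn_integral_gaussian_exp_linear [OF assms, of w] in auto)
  then show ?I "(\<integral>x. exp (Re (\<Sum>\<alpha>\<in>\<Lambda>. w \<alpha> * x \<alpha>)) \<partial>gaussian_family \<Lambda>) = exp ((\<Sum>\<alpha>\<in>\<Lambda>. (cmod (w \<alpha>))\<^sup>2) / 4)"
    by (auto simp: has_bochner_integral_iff)
qed

text \<open>The product formula \<open>cosh X * cosh Y = (cosh (X + Y) + cosh (X - Y)) / 2\<close>
  reduces the mixed moment to exponential moments of \<open>w + w'\<close> and
  \<open>w - w'\<close>. Relative to the product of the two means, the mixed moment carries the
  factor \<open>cosh\<close> of the covariance of \<open>X\<close> and \<open>Y\<close>, which is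
  half the real inner product of \<open>w\<close> and \<open>w'\<close>.\<close>

lemma gaussian_cosh_linear:
  fixes w w' :: "'i \<Rightarrow> complex"
  assumes "finite \<Lambda>"
  defines "X \<equiv> \<lambda>x. Re (\<Sum>\<alpha>\<in>\<Lambda>. w \<alpha> * x \<alpha>)" and "Y \<equiv> \<lambda>x. Re (\<Sum>\<alpha>\<in>\<Lambda>. w' \<alpha> * x \<alpha>)"
  shows "has_bochner_integral (gaussian_family \<Lambda>) (\<lambda>x. cosh (X x)) (exp ((\<Sum>\<alpha>\<in>\<Lambda>. (cmod (w \<alpha>))\<^sup>2) / 4))"
    and "has_bochner_integral (gaussian_family \<Lambda>) (\<lambda>x. cosh (X x) * cosh (Y x))
      (exp (((\<Sum>\<alpha>\<in>\<Lambda>. (cmod (w \<alpha>))\<^sup>2) + (\<Sum>\<alpha>\<in>\<Lambda>. (cmod (w' \<alpha>))\<^sup>2)) / 4) * cosh (Re (\<Sum>\<alpha>\<in>\<Lambda>. w \<alpha> * cnj (w' \<alpha>)) / 2))"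
proof -
  define Q where "Q u = (\<Sum>\<alpha>\<in>\<Lambda>. (cmod (u \<alpha>))\<^sup>2)" for u :: "'i \<Rightarrow> complex"
  have E: "has_bochner_integral (gaussian_family \<Lambda>) (\<lambda>x. exp (Re (\<Sum>\<alpha>\<in>\<Lambda>. u \<alpha> * x \<alpha>))) (exp (Q u / 4))" for u
    using gaussian_exp_linear [OF assms(1), of u] by (simp add: has_bochner_integral_iff Q_def)
  have C: "has_bochner_integral (gaussian_family \<Lambda>) (\<lambda>x. cosh (Re (\<Sum>\<alpha>\<in>\<Lambda>. u \<alpha> * x \<alpha>))) (exp (Q u / 4))" for u
    using has_bochner_integral_divide [OF has_bochner_integral_add [OF E [of u] E [of "\<lambda>\<alpha>. - u \<alpha>"]], of 2]
    by (simp add: cosh_def Q_def sum_negf field_simps)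
  show "has_bochner_integral (gaussian_family \<Lambda>) (\<lambda>x. cosh (X x)) (exp ((\<Sum>\<alpha>\<in>\<Lambda>. (cmod (w \<alpha>))\<^sup>2) / 4))"
    using C [of w] by (simp add: X_def Q_def)
  define p where "p = Re (\<Sum>\<alpha>\<in>\<Lambda>. w \<alpha> * cnj (w' \<alpha>))"
  have Qp: "Q (\<lambda>\<alpha>. w \<alpha> + w' \<alpha>) = Q w + Q w' + 2 * p" and Qm: "Q (\<lambda>\<alpha>. w \<alpha> - w' \<alpha>) = Q w + Q w' - 2 * p"
    unfolding Q_def p_def Re_sum sum_distrib_left sum.distrib [symmetric] sum_subtractf [symmetric] cmod_power2
    by (auto intro!: sum.cong simp: power2_eq_square algebra_simps)
  have cosh_prod: "cosh a * cosh b = (cosh (a + b) + cosh (a - b)) / 2" for a b :: real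
    by (simp add: cosh_add cosh_diff)
  have 1: "has_bochner_integral (gaussian_family \<Lambda>) (\<lambda>x. cosh (X x) * cosh (Y x))
      ((exp (Q (\<lambda>\<alpha>. w \<alpha> + w' \<alpha>) / 4) + exp (Q (\<lambda>\<alpha>. w \<alpha> - w' \<alpha>) / 4)) / 2)"
    using has_bochner_integral_divide [OF has_bochner_integral_add [OF C [of "\<lambda>\<alpha>. w \<alpha> + w' \<alpha>"] C [of "\<lambda>\<alpha>. w \<alpha> - w' \<alpha>"]], of 2]
    by (simp add: cosh_prod X_def Y_def ring_distribs sum.distrib sum_subtractf)
  have "(exp (Q (\<lambda>\<alpha>. w \<alpha> + w' \<alpha>) / 4) + exp (Q (\<lambda>\<alpha>. w \<alpha> - w' \<alpha>) / 4)) / 2 = exp ((Q w + Q w') / 4) * cosh (p / 2)"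
  proof -
    have "Q (\<lambda>\<alpha>. w \<alpha> + w' \<alpha>) / 4 = (Q w + Q w') / 4 + p / 2" "Q (\<lambda>\<alpha>. w \<alpha> - w' \<alpha>) / 4 = (Q w + Q w') / 4 + - (p / 2)"
      unfolding Qp Qm by (simp_all add: add_divide_distrib diff_divide_distrib)
    then show ?thesis
      by (simp only: exp_add) (simp add: cosh_def distrib_left)
  qed
  with 1 show "has_bochner_integral (gaussian_family \<Lambda>) (\<lambda>x. cosh (X x) * cosh (Y x))
      (exp (((\<Sum>\<alpha>\<in>\<Lambda>. (cmod (w \<alpha>))\<^sup>2) + (\<Sum>\<alpha>\<in>\<Lambda>. (cmod (w' \<alpha>))\<^sup>2)) / 4) * cosh (Re (\<Sum>\<alpha>\<in>\<Lambda>. w \<alpha> * cnj (w' \<alpha>)) / 2))"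
    by (simp add: Q_def p_def)
qed

text \<open>Chernoff bound with parameter 1/2: each coordinate contributes a factor 2 to the mean of
  \<open>exp (|x|^2 / 2)\<close>, and Markov's inequality is applied at level
  \<open>exp (card \<Lambda>)\<close>. Since \<open>2 < exp 1\<close>, the bound decays with the
  number of coordinates.\<close>

lemma gaussian_norm_tail:
  assumes "finite \<Lambda>"
  shows "measure (gaussian_family \<Lambda>) {x \<in> \<Lambda> \<rightarrow>\<^sub>E UNIV. (\<Sum>\<alpha>\<in>\<Lambda>. (cmod (x \<alpha>))\<^sup>2) \<ge> 2 * card \<Lambda>} \<le> (2 / exp 1) ^ card \<Lambda>"
proof -
  interpret prob_space "gaussian_family \<Lambda>" by (rule prob_space_gaussian_family [OF assms])
  let ?Q = "\<lambda>x. (\<Sum>\<alpha>\<in>\<Lambda>. (cmod (x \<alpha>))\<^sup>2)"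
  have "(\<integral>\<^sup>+x. ennreal (exp (?Q x / 2)) \<partial>gaussian_family \<Lambda>)
      = (\<integral>\<^sup>+x. ennreal (\<Prod>\<alpha>\<in>\<Lambda>. exp ((cmod (x \<alpha>))\<^sup>2 / 2)) \<partial>gaussian_family \<Lambda>)"
    using assms by (simp add: exp_sum sum_divide_distrib)
  also have "\<dots> = (\<Prod>\<alpha>\<in>\<Lambda>. \<integral>\<^sup>+z. ennreal (exp (- (cmod z)\<^sup>2) * exp ((cmod z)\<^sup>2 / 2) / pi) \<partial>lborel)"
    using assms by (intro nn_integral_gaussian_family_prod) auto
  also have "(\<integral>\<^sup>+z. ennreal (exp (- (cmod z)\<^sup>2) * exp ((cmod z)\<^sup>2 / 2) / pi) \<partial>lborel)
      = (\<integral>\<^sup>+z. ennreal (1 / pi) * ennreal (exp (- (cmod (z - 0))\<^sup>2 / (2 * 1\<^sup>2))) \<partial>lborel)"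
    by (intro nn_integral_cong) (simp add: exp_add [symmetric] ennreal_mult' [symmetric] field_simps)
  also have "\<dots> = ennreal (1 / pi) * ennreal (2 * pi * 1\<^sup>2)"
    by (subst nn_integral_cmult) (simp, subst nn_integral_complex_gaussian, simp_all)
  also have "\<dots> = 2"
    by (simp add: ennreal_mult' [symmetric])
  finally have mgf: "(\<integral>\<^sup>+x. ennreal (exp (?Q x / 2)) \<partial>gaussian_family \<Lambda>) = ennreal (2 ^ card \<Lambda>)"
    by (simp add: ennreal_power flip: ennreal_numeral)
  \<comment> \<open>The event is rewritten in the form \<open>1 \<le> c * u x\<close> that Markov's
    inequality for nonnegative integrals expects.\<close>
  have eq: "{x \<in> \<Lambda> \<rightarrow>\<^sub>E UNIV. ?Q x \<ge> 2 * card \<Lambda>}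
      = {x \<in> space (gaussian_family \<Lambda>). 1 \<le> ennreal (exp (- real (card \<Lambda>))) * ennreal (exp (?Q x / 2))}"
    by (auto simp: ennreal_mult' [symmetric] exp_add [symmetric])
  have "emeasure (gaussian_family \<Lambda>) {x \<in> \<Lambda> \<rightarrow>\<^sub>E UNIV. ?Q x \<ge> 2 * card \<Lambda>}
      \<le> ennreal (exp (- real (card \<Lambda>))) * (\<integral>\<^sup>+x. ennreal (exp (?Q x / 2)) * indicator (space (gaussian_family \<Lambda>)) x \<partial>gaussian_family \<Lambda>)"
    unfolding eq by (intro nn_integral_Markov_inequality borel_measurable_times_ennreal borel_measurable_indicator sets.top) measurable
  also have "(\<integral>\<^sup>+x. ennreal (exp (?Q x / 2)) * indicator (space (gaussian_family \<Lambda>)) x \<partial>gaussian_family \<Lambda>) = ennreal (2 ^ card \<Lambda>)"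
    unfolding mgf [symmetric] by (intro nn_integral_cong) auto
  also have "ennreal (exp (- real (card \<Lambda>))) * ennreal (2 ^ card \<Lambda>) = ennreal ((2 / exp 1) ^ card \<Lambda>)"
    by (simp add: ennreal_mult' [symmetric] exp_minus power_divide exp_of_nat_mult [symmetric] field_simps)
  finally show ?thesis
    by (simp add: emeasure_eq_measure)
qed

section \<open>Surface measure as the radial image of Gaussian measure\<close>

text \<open>Multiplication by \<open>r\<close> scales planar Lebesgue measure by
  \<open>r\<^sup>2\<close>. The rescaled image measure therefore agrees with the product measure on
  boxes, and product measures are determined by boxes.\<close>

lemma lebesgue_family_scale:
  assumes "finite \<Lambda>" "r > 0" and A: "A \<in> sets (lebesgue_family \<Lambda>)"
  shows "ennreal (r ^ (2 * card \<Lambda>)) *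
      emeasure (lebesgue_family \<Lambda>) {x \<in> \<Lambda> \<rightarrow>\<^sub>E UNIV. (\<lambda>\<alpha>\<in>\<Lambda>. complex_of_real r * x \<alpha>) \<in> A}
    = emeasure (lebesgue_family \<Lambda>) A"
proof -
  interpret product_sigma_finite "\<lambda>_ :: 'a. lborel :: complex measure"
    by (simp add: product_sigma_finite_def lborel.sigma_finite_measure_axioms)
  let ?s = "\<lambda>x. \<lambda>\<alpha>\<in>\<Lambda>. complex_of_real r * x \<alpha>"
  have s [measurable]: "?s \<in> measurable (lebesgue_family \<Lambda>) (lebesgue_family \<Lambda>)"
  proof -
    have "?s \<in> measurable (lebesgue_family \<Lambda>) (\<Pi>\<^sub>M \<alpha>\<in>\<Lambda>. lborel)"
      by (rule measurable_restrict) simp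
    then show ?thesis by (simp add: lebesgue_family_def)
  qed
  have one: "ennreal (r\<^sup>2) * emeasure lborel {z. complex_of_real r * z \<in> C} = emeasure lborel C"
    if [measurable]: "C \<in> sets borel" for C
  proof -
    have "emeasure lborel C = emeasure (density (distr lborel borel (\<lambda>z. 0 + r *\<^sub>R z)) (\<lambda>_. \<bar>r\<bar> ^ DIM(complex))) C"
      using lborel_affine [of r "0 :: complex"] \<open>r > 0\<close> by simp
    also have "\<dots> = ennreal (r\<^sup>2) * emeasure (distr lborel borel (\<lambda>z. r *\<^sub>R z)) C"
      using \<open>r > 0\<close> by (simp add: emeasure_density nn_integral_cmult)
    also have "emeasure (distr lborel borel (\<lambda>z. r *\<^sub>R z)) C = emeasure lborel {z. complex_of_real r * z \<in> C}"
      by (subst emeasure_distr) (auto simp: scaleR_conv_of_real vimage_def)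
    finally show ?thesis ..
  qed
  define P where "P = scale_measure (ennreal (r ^ (2 * card \<Lambda>))) (distr (lebesgue_family \<Lambda>) (lebesgue_family \<Lambda>) ?s)"
  have "P = (\<Pi>\<^sub>M \<alpha>\<in>\<Lambda>. lborel)"
  proof (rule PiM_eqI)
    show "finite \<Lambda>" by fact
    show "sets P = sets (\<Pi>\<^sub>M \<alpha>\<in>\<Lambda>. lborel)"
      by (simp add: P_def lebesgue_family_def)
    fix C :: "'a \<Rightarrow> complex set" assume C: "\<And>i. i \<in> \<Lambda> \<Longrightarrow> C i \<in> sets lborel"
    have "?s -` Pi\<^sub>E \<Lambda> C \<inter> space (lebesgue_family \<Lambda>) = (\<Pi>\<^sub>E \<alpha>\<in>\<Lambda>. {z. complex_of_real r * z \<in> C \<alpha>})"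
      by (auto simp: space_lebesgue_family PiE_iff)
    moreover have "Pi\<^sub>E \<Lambda> C \<in> sets (lebesgue_family \<Lambda>)"
      unfolding lebesgue_family_def using \<open>finite \<Lambda>\<close> C by (intro sets_PiM_I_finite) auto
    ultimately have "emeasure P (Pi\<^sub>E \<Lambda> C) = ennreal (r ^ (2 * card \<Lambda>)) * emeasure (lebesgue_family \<Lambda>) (\<Pi>\<^sub>E \<alpha>\<in>\<Lambda>. {z. complex_of_real r * z \<in> C \<alpha>})"
      by (simp add: P_def emeasure_distr)
    also have "emeasure (lebesgue_family \<Lambda>) (\<Pi>\<^sub>E \<alpha>\<in>\<Lambda>. {z. complex_of_real r * z \<in> C \<alpha>})
        = (\<Prod>\<alpha>\<in>\<Lambda>. emeasure lborel {z. complex_of_real r * z \<in> C \<alpha>})"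
      unfolding lebesgue_family_def using \<open>finite \<Lambda>\<close>
    proof (intro emeasure_PiM)
      fix \<alpha> assume "\<alpha> \<in> \<Lambda>"
      then have [measurable]: "C \<alpha> \<in> sets borel" using C by simp
      have "{z \<in> space borel. complex_of_real r * z \<in> C \<alpha>} \<in> sets borel" by measurable
      then show "{z. complex_of_real r * z \<in> C \<alpha>} \<in> sets lborel" by simp
    qed
    also have "ennreal (r ^ (2 * card \<Lambda>)) * (\<Prod>\<alpha>\<in>\<Lambda>. emeasure lborel {z. complex_of_real r * z \<in> C \<alpha>})
        = (\<Prod>\<alpha>\<in>\<Lambda>. ennreal (r\<^sup>2) * emeasure lborel {z. complex_of_real r * z \<in> C \<alpha>})"
      using \<open>r > 0\<close> by (simp add: prod.distrib power_mult ennreal_power)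
    also have "\<dots> = (\<Prod>\<alpha>\<in>\<Lambda>. emeasure lborel (C \<alpha>))"
      using C by (intro prod.cong refl one) simp
    finally show "emeasure P (Pi\<^sub>E \<Lambda> C) = (\<Prod>\<alpha>\<in>\<Lambda>. emeasure lborel (C \<alpha>))" .
  qed
  then have "emeasure (lebesgue_family \<Lambda>) A = emeasure P A"
    by (simp add: lebesgue_family_def)
  also have "\<dots> = ennreal (r ^ (2 * card \<Lambda>)) * emeasure (lebesgue_family \<Lambda>) (?s -` A \<inter> space (lebesgue_family \<Lambda>))"
    using A by (simp add: P_def emeasure_distr)
  also have "?s -` A \<inter> space (lebesgue_family \<Lambda>) = {x \<in> \<Lambda> \<rightarrow>\<^sub>E UNIV. ?s x \<in> A}"
    by (auto simp: space_lebesgue_family)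
  finally show ?thesis ..
qed

lemma lp_norm_2_power2: "(lp_norm 2 \<Lambda> a)\<^sup>2 = (\<Sum>\<alpha>\<in>\<Lambda>. (cmod (a \<alpha>))\<^sup>2)"
  by (simp add: lp_norm_def powr_half_sqrt sum_nonneg)

lemma radial_in_unit_sphere: "0 < lp_norm 2 \<Lambda> a \<Longrightarrow> radial \<Lambda> a \<in> unit_sphere \<Lambda>"
  using lp_norm_2_scale [of "inverse (lp_norm 2 \<Lambda> a)" \<Lambda> a]
  by (simp add: unit_sphere_def radial_def [abs_def])

lemma radial_scale:
  assumes "r > 0"
  shows "radial \<Lambda> (\<lambda>\<alpha>\<in>\<Lambda>. complex_of_real r * x \<alpha>) = radial \<Lambda> x"
  using assms by (auto simp: radial_def lp_norm_2_scale fun_eq_iff)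

lemma nn_integral_exp_tail: "(\<integral>\<^sup>+t. ennreal (exp (- t)) * indicator {c..} t \<partial>lborel) = ennreal (exp (- c))"
proof -
  have "(\<integral>\<^sup>+t. ennreal (exp (- t)) * indicator {c..} t \<partial>lborel) = ennreal (0 - (- exp (- c)))"
  proof (rule nn_integral_FTC_atLeast)
    show "((\<lambda>t. - exp (- t)) has_real_derivative exp (- t)) (at t)" for t :: real
      by (auto intro!: derivative_eq_intros)
    have "((\<lambda>t :: real. exp (- t)) \<longlongrightarrow> 0) at_top"
      by (rule filterlim_compose [OF exp_at_bot filterlim_uminus_at_bot_at_top])
    then show "((\<lambda>t :: real. - exp (- t)) \<longlongrightarrow> 0) at_top"
      using tendsto_minus by fastforce
  qed auto
  then show ?thesis by simp
qed

text \<open>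
  Layer-cake argument: \<open>exp (-|x|\<^sup>2)\<close> is the integral of \<open>exp (-t)\<close> over \<open>t \<ge> |x|\<^sup>2\<close>, and the part of a full
  cone inside the ball of radius \<open>sqrt t\<close> is a dilate of the part inside the unit ball. The constant is
  the same for all cones, so it need not be evaluated.
\<close>

lemma gaussian_full_cone:
  assumes fin: "finite \<Lambda>" and E: "E \<subseteq> unit_sphere \<Lambda>" and [measurable]: "E \<in> sets (lebesgue_family \<Lambda>)"
  shows "emeasure (gaussian_family \<Lambda>) {x \<in> \<Lambda> \<rightarrow>\<^sub>E UNIV. 0 < lp_norm 2 \<Lambda> x \<and> radial \<Lambda> x \<in> E}
    = (\<integral>\<^sup>+t. ennreal (1 / pi ^ card \<Lambda>) * ennreal (exp (- t)) * ennreal (t ^ card \<Lambda>) * indicator {0<..} t \<partial>lborel)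
      * emeasure (lebesgue_family \<Lambda>) (radial_cone \<Lambda> E)"
proof -
  interpret product_sigma_finite "\<lambda>_ :: 'a. lborel :: complex measure"
    by (simp add: product_sigma_finite_def lborel.sigma_finite_measure_axioms)
  interpret L: finite_product_sigma_finite "\<lambda>_ :: 'a. lborel :: complex measure" \<Lambda>
    by standard fact
  interpret L: sigma_finite_measure "lebesgue_family \<Lambda>"
    unfolding lebesgue_family_def by (rule L.sigma_finite_measure_axioms)
  interpret pair_sigma_finite lborel "lebesgue_family \<Lambda>" ..
  let ?A = "{x \<in> \<Lambda> \<rightarrow>\<^sub>E UNIV. 0 < lp_norm 2 \<Lambda> x \<and> radial \<Lambda> x \<in> E}"
  have "{x \<in> space (lebesgue_family \<Lambda>). 0 < lp_norm 2 \<Lambda> x \<and> radial \<Lambda> x \<in> E} \<in> sets (lebesgue_family \<Lambda>)"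
    by measurable
  then have A [measurable]: "?A \<in> sets (lebesgue_family \<Lambda>)"
    by (simp add: space_lebesgue_family)
  let ?c = "ennreal (1 / pi ^ card \<Lambda>)"
  let ?f = "\<lambda>t x. ?c * ennreal (exp (- t)) * (indicator {(lp_norm 2 \<Lambda> x)\<^sup>2..} t * indicator ?A x)"
  have "emeasure (gaussian_family \<Lambda>) ?A = (\<integral>\<^sup>+x. ?c * ennreal (exp (- (lp_norm 2 \<Lambda> x)\<^sup>2)) * indicator ?A x \<partial>lebesgue_family \<Lambda>)"
    unfolding gaussian_family_def lp_norm_2_power2
    by (subst emeasure_density) (auto intro!: nn_integral_cong simp: ennreal_mult' [symmetric])
  also have "\<dots> = (\<integral>\<^sup>+x. (\<integral>\<^sup>+t. ?f t x \<partial>lborel) \<partial>lebesgue_family \<Lambda>)"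
  proof (intro nn_integral_cong)
    fix x
    have "(\<integral>\<^sup>+t. ?f t x \<partial>lborel) = (\<integral>\<^sup>+t. ?c * indicator ?A x * (ennreal (exp (- t)) * indicator {(lp_norm 2 \<Lambda> x)\<^sup>2..} t) \<partial>lborel)"
      by (intro nn_integral_cong) (simp add: mult_ac)
    also have "\<dots> = ?c * indicator ?A x * ennreal (exp (- (lp_norm 2 \<Lambda> x)\<^sup>2))"
      by (subst nn_integral_cmult) (auto simp: nn_integral_exp_tail)
    finally show "?c * ennreal (exp (- (lp_norm 2 \<Lambda> x)\<^sup>2)) * indicator ?A x = (\<integral>\<^sup>+t. ?f t x \<partial>lborel)"
      by (simp add: mult_ac)
  qed
  also have "\<dots> = (\<integral>\<^sup>+t. (\<integral>\<^sup>+x. ?f t x \<partial>lebesgue_family \<Lambda>) \<partial>lborel)"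
  proof (rule Fubini')
    \<comment> \<open>The indicator of a half-line with moving end point becomes the indicator of
      one fixed measurable subset of the product space, which yields joint measurability.\<close>
    have "(\<lambda>(t, x). ?c * ennreal (exp (- t)) * (indicator {p \<in> space (lborel \<Otimes>\<^sub>M lebesgue_family \<Lambda>). (lp_norm 2 \<Lambda> (snd p))\<^sup>2 \<le> fst p} (t, x) * indicator ?A x))
        \<in> borel_measurable (lborel \<Otimes>\<^sub>M lebesgue_family \<Lambda>)"
      by measurable
    also have "?this \<longleftrightarrow> (\<lambda>(t, x). ?f t x) \<in> borel_measurable (lborel \<Otimes>\<^sub>M lebesgue_family \<Lambda>)"
      by (intro measurable_cong) (auto simp: space_pair_measure indicator_def)
    finally show "(\<lambda>(t, x). ?f t x) \<in> borel_measurable (lborel \<Otimes>\<^sub>M lebesgue_family \<Lambda>)" .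
  qed
  also have "\<dots> = (\<integral>\<^sup>+t. ?c * ennreal (exp (- t)) * ennreal (t ^ card \<Lambda>) * indicator {0<..} t * emeasure (lebesgue_family \<Lambda>) (radial_cone \<Lambda> E) \<partial>lborel)"
  proof (intro nn_integral_cong)
    fix t :: real
    show "(\<integral>\<^sup>+x. ?f t x \<partial>lebesgue_family \<Lambda>)
        = ?c * ennreal (exp (- t)) * ennreal (t ^ card \<Lambda>) * indicator {0<..} t * emeasure (lebesgue_family \<Lambda>) (radial_cone \<Lambda> E)"
    proof (cases "t > 0")
      case False
      \<comment> \<open>Points of the full cone have positive norm, so none of them satisfies
        \<open>(lp_norm 2 \<Lambda> x)\<^sup>2 \<le> t\<close> when \<open>t\<close> is not
        positive.\<close>
      then have zero: "?f t x = 0" for x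
        by (auto simp: indicator_def) (smt (verit) zero_less_power2)
      show ?thesis
        unfolding zero using False by simp
    next
      case True
      \<comment> \<open>Dilation by \<open>1 / sqrt t\<close> carries the part of the full cone with
        squared norm at most \<open>t\<close> onto the cone inside the unit ball.\<close>
      let ?r = "1 / sqrt t"
      let ?B = "{x \<in> ?A. (lp_norm 2 \<Lambda> x)\<^sup>2 \<le> t}"
      have B: "?B = {x \<in> space (lebesgue_family \<Lambda>). x \<in> ?A \<and> (lp_norm 2 \<Lambda> x)\<^sup>2 \<le> t}"
        by (auto simp: space_lebesgue_family)
      have [measurable]: "?B \<in> sets (lebesgue_family \<Lambda>)"
        unfolding B by measurable
      define sc where "sc = (\<lambda>x. \<lambda>\<alpha>\<in>\<Lambda>. complex_of_real ?r * x \<alpha>)"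
      have "?B = {x \<in> \<Lambda> \<rightarrow>\<^sub>E UNIV. sc x \<in> radial_cone \<Lambda> E}"
      proof -
        have "(lp_norm 2 \<Lambda> x)\<^sup>2 \<le> t \<longleftrightarrow> lp_norm 2 \<Lambda> x \<le> sqrt t" for x
          using lp_norm_2_nonneg [of \<Lambda> x] real_le_rsqrt real_sqrt_le_iff sqrt_le_D True
          by (metis real_sqrt_abs abs_of_nonneg)
        moreover have "lp_norm 2 \<Lambda> (sc x) = lp_norm 2 \<Lambda> x / sqrt t" for x
          using lp_norm_2_scale [of ?r \<Lambda> x] True by (simp add: sc_def)
        moreover have "radial \<Lambda> (sc x) = radial \<Lambda> x" for x
          using radial_scale [of ?r \<Lambda> x] True by (simp add: sc_def)
        moreover have "sc x \<in> \<Lambda> \<rightarrow>\<^sub>E UNIV" for x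
          by (simp add: sc_def)
        ultimately show ?thesis
          using True unfolding radial_cone_eq [OF E] by (auto simp: zero_less_divide_iff)
      qed
      then have "ennreal (?r ^ (2 * card \<Lambda>)) * emeasure (lebesgue_family \<Lambda>) ?B = emeasure (lebesgue_family \<Lambda>) (radial_cone \<Lambda> E)"
        using lebesgue_family_scale [OF fin, of ?r "radial_cone \<Lambda> E"] True radial_cone_in_sets [OF E] by (simp add: sc_def)
      then have "ennreal (t ^ card \<Lambda>) * emeasure (lebesgue_family \<Lambda>) (radial_cone \<Lambda> E)
          = ennreal (t ^ card \<Lambda>) * (ennreal (?r ^ (2 * card \<Lambda>)) * emeasure (lebesgue_family \<Lambda>) ?B)"
        by simp
      also have "\<dots> = emeasure (lebesgue_family \<Lambda>) ?B"
        using True by (simp add: mult.assoc [symmetric] ennreal_mult' [symmetric] power_mult power_divide)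
      finally have vol: "emeasure (lebesgue_family \<Lambda>) ?B = ennreal (t ^ card \<Lambda>) * emeasure (lebesgue_family \<Lambda>) (radial_cone \<Lambda> E)" ..
      have "(\<integral>\<^sup>+x. ?f t x \<partial>lebesgue_family \<Lambda>) = (\<integral>\<^sup>+x. ?c * ennreal (exp (- t)) * indicator ?B x \<partial>lebesgue_family \<Lambda>)"
        by (intro nn_integral_cong) (auto simp: indicator_def)
      also have "\<dots> = ?c * ennreal (exp (- t)) * emeasure (lebesgue_family \<Lambda>) ?B"
        by (intro nn_integral_cmult_indicator) measurable
      finally show ?thesis
        unfolding vol using True by (simp add: mult_ac)
    qed
  qed
  also have "\<dots> = (\<integral>\<^sup>+t. ?c * ennreal (exp (- t)) * ennreal (t ^ card \<Lambda>) * indicator {0<..} t \<partial>lborel)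
      * emeasure (lebesgue_family \<Lambda>) (radial_cone \<Lambda> E)"
    by (intro nn_integral_multc) measurable
  finally show ?thesis .
qed

text \<open>Only the origin is missing. It is a Lebesgue null set because the index set is nonempty
  and points of the plane are null, and the Gaussian measure has a density.\<close>

lemma gaussian_nonzero:
  assumes "finite \<Lambda>" "\<Lambda> \<noteq> {}"
  shows "emeasure (gaussian_family \<Lambda>) {x \<in> \<Lambda> \<rightarrow>\<^sub>E UNIV. 0 < lp_norm 2 \<Lambda> x} = 1"
proof -
  interpret product_sigma_finite "\<lambda>_ :: 'a. lborel :: complex measure"
    by (simp add: product_sigma_finite_def lborel.sigma_finite_measure_axioms)
  interpret G: prob_space "gaussian_family \<Lambda>" by (rule prob_space_gaussian_family [OF assms(1)])
  have "{x \<in> space (gaussian_family \<Lambda>). 0 < lp_norm 2 \<Lambda> x} \<in> sets (gaussian_family \<Lambda>)"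
    by measurable
  then have m [measurable]: "{x \<in> \<Lambda> \<rightarrow>\<^sub>E UNIV. 0 < lp_norm 2 \<Lambda> x} \<in> sets (gaussian_family \<Lambda>)"
    by simp
  have z: "(\<Pi>\<^sub>E \<alpha>\<in>\<Lambda>. {0 :: complex}) \<in> sets (lebesgue_family \<Lambda>)"
    unfolding lebesgue_family_def using assms by (intro sets_PiM_I_finite) auto
  have "emeasure (lebesgue_family \<Lambda>) (\<Pi>\<^sub>E \<alpha>\<in>\<Lambda>. {0}) = (\<Prod>\<alpha>\<in>\<Lambda>. emeasure lborel {0 :: complex})"
    unfolding lebesgue_family_def using assms by (intro emeasure_PiM) auto
  also have "\<dots> = 0"
    using assms by (simp add: card_gt_0_iff)
  finally have "(\<Pi>\<^sub>E \<alpha>\<in>\<Lambda>. {0}) \<in> null_sets (lebesgue_family \<Lambda>)"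
    using z by auto
  then have "AE x in lebesgue_family \<Lambda>. x \<notin> (\<Pi>\<^sub>E \<alpha>\<in>\<Lambda>. {0})"
    by (rule AE_not_in)
  then have "AE x in gaussian_family \<Lambda>. x \<notin> (\<Pi>\<^sub>E \<alpha>\<in>\<Lambda>. {0})"
    unfolding gaussian_family_def by (subst AE_density) auto
  moreover have "0 < lp_norm 2 \<Lambda> x" if x: "x \<in> \<Lambda> \<rightarrow>\<^sub>E UNIV" "x \<notin> (\<Pi>\<^sub>E \<alpha>\<in>\<Lambda>. {0})" for x
  proof -
    obtain \<alpha> where "\<alpha> \<in> \<Lambda>" "x \<alpha> \<noteq> 0"
      using x unfolding PiE_iff by blast
    then have "(\<Sum>\<alpha>\<in>\<Lambda>. (cmod (x \<alpha>))\<^sup>2) > 0"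
      using assms by (intro sum_pos2 [of _ \<alpha>]) auto
    then show ?thesis
      using lp_norm_2_nonneg [of \<Lambda> x] unfolding lp_norm_2_power2 [symmetric] by auto
  qed
  ultimately have "AE x in gaussian_family \<Lambda>. x \<in> {x \<in> \<Lambda> \<rightarrow>\<^sub>E UNIV. 0 < lp_norm 2 \<Lambda> x}"
    using AE_space [of "gaussian_family \<Lambda>"] by (auto elim!: eventually_elim2)
  then show ?thesis
    using G.emeasure_eq_1_AE m by blast
qed

text \<open>Both sides are a constant times the volume of the cone over \<open>E\<close>. Both are
  probabilities that give the whole sphere mass 1, so the constants coincide and
  \<open>\<kappa>\<close> never has to be computed.\<close>

lemma sphere_prob_eq_gaussian:
  assumes fin: "finite \<Lambda>" "\<Lambda> \<noteq> {}" and E: "E \<subseteq> unit_sphere \<Lambda>" "E \<in> sets (lebesgue_family \<Lambda>)"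
  shows "emeasure (sphere_prob \<Lambda>) E
    = emeasure (gaussian_family \<Lambda>) {x \<in> \<Lambda> \<rightarrow>\<^sub>E UNIV. 0 < lp_norm 2 \<Lambda> x \<and> radial \<Lambda> x \<in> E}"
proof -
  let ?S = "unit_sphere \<Lambda>" and ?v = "\<lambda>E. emeasure (lebesgue_family \<Lambda>) (radial_cone \<Lambda> E)"
  define \<kappa> where "\<kappa> = (\<integral>\<^sup>+t. ennreal (1 / pi ^ card \<Lambda>) * ennreal (exp (- t)) * ennreal (t ^ card \<Lambda>) * indicator {0<..} t \<partial>lborel)"
  have g: "emeasure (gaussian_family \<Lambda>) {x \<in> \<Lambda> \<rightarrow>\<^sub>E UNIV. 0 < lp_norm 2 \<Lambda> x \<and> radial \<Lambda> x \<in> F} = \<kappa> * ?v F"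
    if "F \<subseteq> ?S" "F \<in> sets (lebesgue_family \<Lambda>)" for F
    using gaussian_full_cone [OF fin(1) that] by (simp add: \<kappa>_def)
  have "{x \<in> \<Lambda> \<rightarrow>\<^sub>E UNIV. 0 < lp_norm 2 \<Lambda> x \<and> radial \<Lambda> x \<in> ?S} = {x \<in> \<Lambda> \<rightarrow>\<^sub>E UNIV. 0 < lp_norm 2 \<Lambda> x}"
    using radial_in_unit_sphere by auto
  then have \<kappa>: "\<kappa> * ?v ?S = 1"
    using g [OF subset_refl unit_sphere_in_sets] gaussian_nonzero [OF fin] by simp
  \<comment> \<open>A product equal to 1 has neither a zero nor an infinite factor; this permits the
    cancellation in extended nonnegative reals below.\<close>
  then have v: "?v ?S \<noteq> 0" "?v ?S \<noteq> top"
    by (auto simp: ennreal_mult_eq_top_iff ennreal_top_mult ennreal_mult_top split: if_splits)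
  have "emeasure (sphere_prob \<Lambda>) E = emeasure (surface_measure \<Lambda>) E / emeasure (surface_measure \<Lambda>) ?S"
    unfolding sphere_prob_def using E unit_sphere_in_sets
    by (subst emeasure_uniform_measure) (auto simp: sets_surface_measure Int_absorb1)
  also have "\<dots> = (of_nat (2 * card \<Lambda>) * ?v E) / (of_nat (2 * card \<Lambda>) * ?v ?S)"
    by (simp only: emeasure_surface_measure [OF E] emeasure_surface_measure [OF subset_refl unit_sphere_in_sets])
  also have "of_nat (2 * card \<Lambda>) * ?v E = (\<kappa> * ?v E) * (of_nat (2 * card \<Lambda>) * ?v ?S)"
    using \<kappa> by (metis mult.commute mult.left_commute mult_1)
  also have "\<dots> / (of_nat (2 * card \<Lambda>) * ?v ?S) = \<kappa> * ?v E"
    using v fin by (intro ennreal_mult_divide_eq) (auto simp: ennreal_mult_eq_top_iff)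
  finally show ?thesis
    using g [OF E] by simp
qed

section \<open>Moments on the discrete torus\<close>

text \<open>Induction on the total: a composition of \<open>Suc g\<close> has a positive entry, and
  lowering it by one gives a composition of \<open>g\<close>. Hence it arises from a pair of a slot
  and a composition of \<open>g\<close>. Finiteness runs through the same induction because the
  cardinality bounds for images rely on it.\<close>

lemma card_compositions_le:
  "finite {h \<in> {..<k} \<rightarrow>\<^sub>E (UNIV :: nat set). (\<Sum>i<k. h i) = g} \<and>
   card {h \<in> {..<k} \<rightarrow>\<^sub>E (UNIV :: nat set). (\<Sum>i<k. h i) = g} \<le> k ^ g"
proof (induction g)
  case 0
  let ?C = "{h \<in> {..<k} \<rightarrow>\<^sub>E (UNIV :: nat set). (\<Sum>i<k. h i) = 0}"
  have sub: "?C \<subseteq> {\<lambda>i\<in>{..<k}. 0}"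
  proof
    fix h assume "h \<in> ?C"
    then have "h = (\<lambda>i\<in>{..<k}. 0)"
      by (intro PiE_ext [of h "{..<k}" "\<lambda>_. UNIV"]) auto
    then show "h \<in> {\<lambda>i\<in>{..<k}. 0}" by simp
  qed
  have "finite ?C" by (rule finite_subset [OF sub]) simp
  moreover have "card ?C \<le> 1" using card_mono [OF _ sub] by simp
  ultimately show ?case by simp
next
  case (Suc g)
  let ?C = "\<lambda>g. {h \<in> {..<k} \<rightarrow>\<^sub>E (UNIV :: nat set). (\<Sum>i<k. h i) = g}"
  have sub: "?C (Suc g) \<subseteq> (\<lambda>(i, h). h(i := Suc (h i))) ` ({..<k} \<times> ?C g)"
  proof
    fix h assume h: "h \<in> ?C (Suc g)"
    then obtain i where i: "i < k" "h i > 0"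
      by (metis (mono_tags, lifting) gr_zeroI lessThan_iff mem_Collect_eq nat.distinct(1) sum.neutral)
    define h' where "h' = h(i := h i - 1)"
    have "(\<Sum>i<k. h i) = Suc (\<Sum>i<k. h' i)"
      using i by (simp add: h'_def sum.remove [of "{..<k}" i])
    then have "h' \<in> ?C g"
      using h i by (auto simp: h'_def PiE_iff extensional_def)
    moreover have "h = h'(i := Suc (h' i))"
      using i by (auto simp: h'_def)
    ultimately show "h \<in> (\<lambda>(i, h). h(i := Suc (h i))) ` ({..<k} \<times> ?C g)"
      using i by force
  qed
  have fin: "finite ({..<k} \<times> ?C g)" using Suc by auto
  have "card (?C (Suc g)) \<le> card ({..<k} \<times> ?C g)"
    by (rule le_trans [OF card_mono [OF finite_imageI [OF fin] sub] card_image_le [OF fin]])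
  also have "\<dots> \<le> k * k ^ g"
    using Suc by (simp add: card_cartesian_product)
  finally show ?case
    using finite_subset [OF sub] fin by auto
qed

text \<open>
  A family of \<open>k\<close> multi-indices with prescribed sum \<open>\<gamma>\<close> distributes each of the \<open>|\<gamma>|\<close> units
  of \<open>\<gamma>\<close> to one of the \<open>k\<close> members.
\<close>

lemma card_multiindex_decompositions_le:
  fixes n :: nat
  assumes "\<Lambda> \<subseteq> {..<n} \<rightarrow>\<^sub>E (UNIV :: nat set)"
  shows "card {h \<in> {..<k} \<rightarrow>\<^sub>E \<Lambda>. \<forall>j<n. (\<Sum>i<k. h i j) = \<gamma> j} \<le> k ^ (\<Sum>j<n. \<gamma> j)"
proof -
  let ?H = "{h \<in> {..<k} \<rightarrow>\<^sub>E \<Lambda>. \<forall>j<n. (\<Sum>i<k. h i j) = \<gamma> j}"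
  let ?C = "\<lambda>g. {h \<in> {..<k} \<rightarrow>\<^sub>E (UNIV :: nat set). (\<Sum>i<k. h i) = g}"
  \<comment> \<open>Transposing the family gives, for each coordinate \<open>j\<close>, a
    composition of \<open>\<gamma> j\<close> into \<open>k\<close> parts; the counts per coordinate
    then multiply.\<close>
  let ?t = "\<lambda>h. \<lambda>j\<in>{..<n}. \<lambda>i\<in>{..<k}. h i j"
  have "inj_on ?t ?H"
  proof (rule inj_onI)
    fix h h' assume h: "h \<in> ?H" "h' \<in> ?H" and eq: "?t h = ?t h'"
    have "h i j = h' i j" if "i < k" "j < n" for i j
      using fun_cong [OF fun_cong [OF eq, of j], of i] that by simp
    moreover have "h i \<in> {..<n} \<rightarrow>\<^sub>E UNIV" "h' i \<in> {..<n} \<rightarrow>\<^sub>E UNIV" if "i < k" for i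
      using h that assms by (auto simp: PiE_iff subset_iff)
    ultimately have "h i = h' i" if "i < k" for i
      using that by (intro PiE_ext [of "h i" "{..<n}" "\<lambda>_. UNIV" "h' i"]) auto
    then show "h = h'"
      using h by (intro PiE_ext [of h "{..<k}" "\<lambda>_. \<Lambda>" h']) auto
  qed
  moreover have "?t ` ?H \<subseteq> (\<Pi>\<^sub>E j\<in>{..<n}. ?C (\<gamma> j))"
    by (auto simp: PiE_iff)
  moreover have "finite (\<Pi>\<^sub>E j\<in>{..<n}. ?C (\<gamma> j))"
    by (intro finite_PiE) (auto simp: card_compositions_le)
  ultimately have "card ?H \<le> card (\<Pi>\<^sub>E j\<in>{..<n}. ?C (\<gamma> j))"
    by (meson card_inj_on_le)
  also have "\<dots> = (\<Prod>j<n. card (?C (\<gamma> j)))"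
    by (simp add: card_PiE)
  also have "\<dots> \<le> (\<Prod>j<n. k ^ \<gamma> j)"
    by (intro prod_mono) (auto simp: card_compositions_le)
  also have "\<dots> = k ^ (\<Sum>j<n. \<gamma> j)"
    by (simp add: power_sum)
  finally show ?thesis .
qed

section \<open>Orthogonality and even moments over grids of roots of unity\<close>

definition root_unity :: "nat \<Rightarrow> nat \<Rightarrow> complex" where
  "root_unity L g = cis (2 * pi * real g / real L)"

lemma norm_root_unity [simp]: "cmod (root_unity L g) = 1"
  by (simp add: root_unity_def)

text \<open>For \<open>p \<noteq> q\<close> this is a geometric sum in an \<open>L\<close>-th root
  of unity \<open>\<omega>\<close>. The bounds \<open>p < L\<close> and \<open>q < L\<close> prevent
  \<open>p - q\<close> from being a nonzero multiple of \<open>L\<close>, so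
  \<open>\<omega> \<noteq> 1\<close> and the sum vanishes.\<close>

lemma sum_root_unity_powers:
  assumes "p < L" "q < L"
  shows "(\<Sum>g<L. root_unity L g ^ p * cnj (root_unity L g ^ q)) = (if p = q then of_nat L else 0)"
proof (cases "p = q")
  case True
  have "root_unity L g ^ p * cnj (root_unity L g ^ p) = 1" for g
    using complex_norm_square [of "root_unity L g ^ p"] by (simp add: norm_power)
  then show ?thesis using True by simp
next
  case False
  define \<omega> where "\<omega> = cis (2 * pi * (real p - real q) / real L)"
  have "root_unity L g ^ p * cnj (root_unity L g ^ q) = \<omega> ^ g" for g
    by (simp add: root_unity_def \<omega>_def Complex.DeMoivre cis_cnj cis_mult field_simps diff_divide_distrib)
  then have "(\<Sum>g<L. root_unity L g ^ p * cnj (root_unity L g ^ q)) = (\<Sum>g<L. \<omega> ^ g)"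
    by simp
  also have "\<dots> = 0"
  proof -
    have "\<omega> ^ L = 1"
    proof -
      have "\<omega> ^ L = cis (2 * pi * of_int (int p - int q))"
        using assms by (simp add: \<omega>_def Complex.DeMoivre)
      then show ?thesis
        by (metis Ints_of_int cis_multiple_2pi)
    qed
    moreover have "\<omega> \<noteq> 1"
    proof
      assume "\<omega> = 1"
      then have "cos (2 * pi * (real p - real q) / real L) = 1"
        by (simp add: \<omega>_def complex_eq_iff)
      then obtain z :: int where "2 * pi * (real p - real q) / real L = of_int z * 2 * pi"
        by (auto simp: cos_one_2pi_int)
      then have "2 * pi * (real p - real q) = 2 * pi * (of_int z * real L)"
        using assms by (simp add: field_simps)
      then have "real p - real q = of_int z * real L"
        by simp
      then have "int p - int q = z * int L"
        by (metis of_int_diff of_int_eq_iff of_int_mult of_int_of_nat_eq)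
      then have pq: "\<bar>int p - int q\<bar> = \<bar>z\<bar> * int L"
        by (simp add: abs_mult)
      have "z = 0"
      proof (rule ccontr)
        assume "z \<noteq> 0"
        then have "1 * int L \<le> \<bar>z\<bar> * int L"
          by (intro mult_right_mono) auto
        then show False using pq assms by linarith
      qed
      then show False using pq False by simp
    qed
    ultimately show ?thesis
      using geometric_sum [of \<omega> L] by simp
  qed
  finally show ?thesis using False by simp
qed

definition torus_point :: "nat \<Rightarrow> (nat \<Rightarrow> nat) \<Rightarrow> nat \<Rightarrow> complex" where
  "torus_point L g j = root_unity L (g j)"

definition monom_at :: "nat \<Rightarrow> (nat \<Rightarrow> complex) \<Rightarrow> (nat \<Rightarrow> nat) \<Rightarrow> complex" where
  "monom_at n z \<alpha> = (\<Prod>j<n. z j ^ \<alpha> j)"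

lemma norm_monom_torus_point [simp]: "cmod (monom_at n (torus_point L g) \<alpha>) = 1"
  by (simp add: monom_at_def torus_point_def norm_power flip: prod_norm)

text \<open>The sum over the grid factorizes into one-variable sums. As long as all exponents stay
  below \<open>L\<close>, the finite grid reproduces exactly the orthogonality of monomials on the
  torus and replaces integration there.\<close>

lemma sum_torus_monom:
  assumes "\<And>j. j < n \<Longrightarrow> \<beta> j < L" "\<And>j. j < n \<Longrightarrow> \<gamma> j < L"
  shows "(\<Sum>g\<in>{..<n} \<rightarrow>\<^sub>E {..<L}. monom_at n (torus_point L g) \<beta> * cnj (monom_at n (torus_point L g) \<gamma>))
    = (if \<forall>j<n. \<beta> j = \<gamma> j then of_nat (L ^ n) else 0)"
proof -
  have "(\<Sum>g\<in>{..<n} \<rightarrow>\<^sub>E {..<L}. monom_at n (torus_point L g) \<beta> * cnj (monom_at n (torus_point L g) \<gamma>))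
      = (\<Sum>g\<in>{..<n} \<rightarrow>\<^sub>E {..<L}. \<Prod>j<n. root_unity L (g j) ^ \<beta> j * cnj (root_unity L (g j) ^ \<gamma> j))"
    by (simp add: monom_at_def torus_point_def prod.distrib)
  also have "\<dots> = (\<Prod>j<n. \<Sum>g<L. root_unity L g ^ \<beta> j * cnj (root_unity L g ^ \<gamma> j))"
    by (rule prod_sum_PiE [symmetric]) auto
  also have "\<dots> = (\<Prod>j<n. if \<beta> j = \<gamma> j then of_nat L else 0)"
    by (intro prod.cong refl sum_root_unity_powers) (simp_all add: assms)
  also have "\<dots> = (if \<forall>j<n. \<beta> j = \<gamma> j then of_nat (L ^ n) else 0)"
  proof (cases "\<forall>j<n. \<beta> j = \<gamma> j")
    case False
    then obtain j where "j < n" "\<beta> j \<noteq> \<gamma> j" by blast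
    then have "(\<Prod>j<n. if \<beta> j = \<gamma> j then of_nat L else (0 :: complex)) = 0"
      by (intro prod_zero bexI [of _ j]) auto
    then show ?thesis using False by simp
  qed simp
  finally show ?thesis .
qed

text \<open>
  The left-hand side counts pairs of \<open>k\<close>-tuples from \<open>\<Lambda>\<close> with equal sums, weighted by
  numbers of modulus at most one: an elementary substitute for hypercontractivity on the torus.
\<close>

lemma torus_moment_le:
  fixes c :: "(nat \<Rightarrow> nat) \<Rightarrow> complex"
  assumes \<Lambda>: "\<Lambda> \<subseteq> multiindices m n" "finite \<Lambda>" and c: "\<And>\<alpha>. \<alpha> \<in> \<Lambda> \<Longrightarrow> cmod (c \<alpha>) \<le> 1" and L: "m * k < L"
  shows "(\<Sum>g\<in>{..<n} \<rightarrow>\<^sub>E {..<L}. cmod (\<Sum>\<alpha>\<in>\<Lambda>. c \<alpha> * monom_at n (torus_point L g) \<alpha>) ^ (2 * k))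
    \<le> real (L ^ n) * (real (k ^ (m * k)) * real (card \<Lambda> ^ k))"
proof -
  let ?G = "{..<n} \<rightarrow>\<^sub>E {..<L}" and ?F = "{..<k} \<rightarrow>\<^sub>E \<Lambda>"
  \<comment> \<open>In the expanded \<open>k\<close>-th power, the term chosen by the tuple
    \<open>f\<close> has exponent \<open>s f\<close> and coefficient \<open>b f\<close>.\<close>
  define s where "s f j = (\<Sum>i<k. f i j)" for f :: "nat \<Rightarrow> nat \<Rightarrow> nat" and j
  define b where "b f = (\<Prod>i<k. c (f i))" for f :: "nat \<Rightarrow> nat \<Rightarrow> nat"
  have finF: "finite ?F" using \<Lambda> by (intro finite_PiE) auto
  have deg: "(\<Sum>j<n. s f j) = m * k" if "f \<in> ?F" for f
  proof -
    have "(\<Sum>j<n. s f j) = (\<Sum>i<k. \<Sum>j<n. f i j)"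
      unfolding s_def by (rule sum.swap)
    also have "\<dots> = (\<Sum>i<k. m)"
    proof (intro sum.cong refl)
      fix i assume "i \<in> {..<k}"
      then have "f i \<in> multiindices m n" using that \<Lambda> by blast
      then show "(\<Sum>j<n. f i j) = m" by (simp add: multiindices_def)
    qed
    finally show ?thesis by simp
  qed
  \<comment> \<open>Each exponent is bounded by the total degree \<open>m * k\<close>; this is where
    \<open>m * k < L\<close> enters, so that no two distinct exponents are identified on the
    grid.\<close>
  have less: "s f j < L" if "f \<in> ?F" "j < n" for f j
  proof -
    have "s f j \<le> (\<Sum>j<n. s f j)" using that by (intro member_le_sum) auto
    then show ?thesis using deg that L by simp
  qed
  have pow: "(\<Sum>\<alpha>\<in>\<Lambda>. c \<alpha> * monom_at n z \<alpha>) ^ k = (\<Sum>f\<in>?F. b f * monom_at n z (s f))" for z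
  proof -
    have "(\<Sum>\<alpha>\<in>\<Lambda>. c \<alpha> * monom_at n z \<alpha>) ^ k = (\<Prod>i<k. \<Sum>\<alpha>\<in>\<Lambda>. c \<alpha> * monom_at n z \<alpha>)"
      by simp
    also have "\<dots> = (\<Sum>f\<in>?F. \<Prod>i<k. c (f i) * monom_at n z (f i))"
      using \<Lambda> by (intro prod_sum_PiE) auto
    also have "\<dots> = (\<Sum>f\<in>?F. b f * monom_at n z (s f))"
    proof (intro sum.cong refl)
      fix f
      have "(\<Prod>i<k. monom_at n z (f i)) = monom_at n z (s f)"
        unfolding monom_at_def s_def power_sum by (rule prod.swap)
      then show "(\<Prod>i<k. c (f i) * monom_at n z (f i)) = b f * monom_at n z (s f)"
        by (simp add: b_def prod.distrib)
    qed
    finally show ?thesis .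
  qed
  have "complex_of_real (\<Sum>g\<in>?G. cmod (\<Sum>\<alpha>\<in>\<Lambda>. c \<alpha> * monom_at n (torus_point L g) \<alpha>) ^ (2 * k))
      = (\<Sum>g\<in>?G. (\<Sum>f\<in>?F. b f * monom_at n (torus_point L g) (s f)) * cnj (\<Sum>h\<in>?F. b h * monom_at n (torus_point L g) (s h)))"
    unfolding of_real_sum
  proof (intro sum.cong refl)
    fix g
    let ?X = "\<Sum>\<alpha>\<in>\<Lambda>. c \<alpha> * monom_at n (torus_point L g) \<alpha>"
    have "complex_of_real (cmod ?X ^ (2 * k)) = complex_of_real ((cmod (?X ^ k))\<^sup>2)"
      by (simp add: norm_power power_mult [symmetric] mult.commute [of 2])
    also have "\<dots> = ?X ^ k * cnj (?X ^ k)"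
      by (simp only: complex_norm_square)
    finally show "complex_of_real (cmod ?X ^ (2 * k)) = (\<Sum>f\<in>?F. b f * monom_at n (torus_point L g) (s f)) * cnj (\<Sum>h\<in>?F. b h * monom_at n (torus_point L g) (s h))"
      by (simp only: pow)
  qed
  also have "\<dots> = (\<Sum>g\<in>?G. \<Sum>f\<in>?F. \<Sum>h\<in>?F. b f * cnj (b h) * (monom_at n (torus_point L g) (s f) * cnj (monom_at n (torus_point L g) (s h))))"
    unfolding cnj_sum sum_product by (intro sum.cong refl) (simp add: mult_ac)
  also have "\<dots> = (\<Sum>f\<in>?F. \<Sum>h\<in>?F. b f * cnj (b h) * (\<Sum>g\<in>?G. monom_at n (torus_point L g) (s f) * cnj (monom_at n (torus_point L g) (s h))))"
    unfolding sum_distrib_left by (subst sum.swap, intro sum.cong refl, rule sum.swap)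
  also have "\<dots> = (\<Sum>f\<in>?F. \<Sum>h\<in>?F. b f * cnj (b h) * (if \<forall>j<n. s f j = s h j then of_nat (L ^ n) else 0))"
  proof (intro sum.cong refl)
    fix f h assume "f \<in> ?F" "h \<in> ?F"
    then show "b f * cnj (b h) * (\<Sum>g\<in>?G. monom_at n (torus_point L g) (s f) * cnj (monom_at n (torus_point L g) (s h)))
        = b f * cnj (b h) * (if \<forall>j<n. s f j = s h j then of_nat (L ^ n) else 0)"
      by (simp only: sum_torus_monom less)
  qed
  finally have "complex_of_real (\<Sum>g\<in>?G. cmod (\<Sum>\<alpha>\<in>\<Lambda>. c \<alpha> * monom_at n (torus_point L g) \<alpha>) ^ (2 * k))
      = (\<Sum>f\<in>?F. \<Sum>h\<in>?F. b f * cnj (b h) * (if \<forall>j<n. s f j = s h j then of_nat (L ^ n) else 0))" (is "complex_of_real ?l = ?r") .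
  then have "cmod (complex_of_real ?l) = cmod ?r"
    by (rule arg_cong)
  then have "\<bar>?l\<bar> = cmod ?r"
    by (simp only: norm_of_real)
  then have "?l \<le> cmod ?r" by linarith
  \<comment> \<open>After the triangle inequality, the coefficients of modulus at most one drop out
    and only the number of pairs with equal exponent sums remains.\<close>
  also have "\<dots> \<le> (\<Sum>f\<in>?F. \<Sum>h\<in>?F. if \<forall>j<n. s f j = s h j then real (L ^ n) else 0)"
  proof (intro sum_norm_le)
    have "cmod (b f) \<le> 1" if "f \<in> ?F" for f
      unfolding b_def prod_norm [symmetric] using that c by (intro prod_le_1) (auto simp: PiE_iff)
    then have le: "cmod (b f) * cmod (b h) \<le> 1" if "f \<in> ?F" "h \<in> ?F" for f h
      using that by (simp add: mult_le_one)
    show "cmod (b f * cnj (b h) * (if \<forall>j<n. s f j = s h j then of_nat (L ^ n) else 0))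
        \<le> (if \<forall>j<n. s f j = s h j then real (L ^ n) else 0)" if "f \<in> ?F" "h \<in> ?F" for f h
    proof (cases "\<forall>j<n. s f j = s h j")
      case True
      then show ?thesis
        using mult_right_mono [of "cmod (b f) * cmod (b h)" 1 "real L ^ n"] le that
        by (simp add: norm_mult norm_power)
    next
      case False
      then show ?thesis by (simp only: if_False mult_zero_right norm_zero le_refl)
    qed
  qed
  also have "\<dots> = (\<Sum>f\<in>?F. real (L ^ n) * real (card {h \<in> ?F. \<forall>j<n. s f j = s h j}))"
  proof (intro sum.cong refl)
    fix f
    have "?F \<inter> {h. \<forall>j<n. s f j = s h j} = {h \<in> ?F. \<forall>j<n. s f j = s h j}"
      by blast
    then show "(\<Sum>h\<in>?F. if \<forall>j<n. s f j = s h j then real (L ^ n) else 0)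
        = real (L ^ n) * real (card {h \<in> ?F. \<forall>j<n. s f j = s h j})"
      using finF by (subst sum.If_cases) auto
  qed
  also have "\<dots> \<le> (\<Sum>f\<in>?F. real (L ^ n) * real (k ^ (m * k)))"
  proof (intro sum_mono mult_left_mono)
    fix f assume f: "f \<in> ?F"
    have eq: "{h \<in> ?F. \<forall>j<n. s f j = s h j} = {h \<in> ?F. \<forall>j<n. (\<Sum>i<k. h i j) = s f j}"
      unfolding s_def by metis
    have "\<Lambda> \<subseteq> {..<n} \<rightarrow>\<^sub>E UNIV"
      using \<Lambda> by (auto simp: multiindices_def)
    then have "card {h \<in> ?F. \<forall>j<n. s f j = s h j} \<le> k ^ (\<Sum>j<n. s f j)"
      unfolding eq by (rule card_multiindex_decompositions_le)
    then show "real (card {h \<in> ?F. \<forall>j<n. s f j = s h j}) \<le> real (k ^ (m * k))"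
      using deg [OF f] by (simp only: of_nat_le_iff)
  qed auto
  also have "\<dots> = real (L ^ n) * (real (k ^ (m * k)) * real (card \<Lambda> ^ k))"
    by (simp add: card_PiE)
  finally show ?thesis .
qed

section \<open>The second moment method\<close>

text \<open>Chebyshev's inequality at half the mean. The common value \<open>s\<close> gives every
  \<open>cosh\<close> term the same mean \<open>exp (s / 4)\<close>, so the relative variance of the
  average is the double average of \<open>cosh\<close> of the covariances, minus 1.\<close>

lemma gaussian_cosh_average:
  fixes v :: "'g \<Rightarrow> 'i \<Rightarrow> complex"
  assumes fin: "finite \<Lambda>" and I: "finite I" "I \<noteq> {}"
    and v: "\<And>i. i \<in> I \<Longrightarrow> (\<Sum>\<alpha>\<in>\<Lambda>. (cmod (v i \<alpha>))\<^sup>2) = s"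
  shows "measure (gaussian_family \<Lambda>)
      {x \<in> \<Lambda> \<rightarrow>\<^sub>E UNIV. (\<Sum>i\<in>I. cosh (Re (\<Sum>\<alpha>\<in>\<Lambda>. v i \<alpha> * x \<alpha>))) / card I \<le> exp (s / 4) / 2}
    \<le> 4 * ((\<Sum>i\<in>I. \<Sum>j\<in>I. cosh (Re (\<Sum>\<alpha>\<in>\<Lambda>. v i \<alpha> * cnj (v j \<alpha>)) / 2)) / (card I)\<^sup>2 - 1)"
proof -
  interpret prob_space "gaussian_family \<Lambda>" by (rule prob_space_gaussian_family [OF fin])
  define X where "X i x = Re (\<Sum>\<alpha>\<in>\<Lambda>. v i \<alpha> * x \<alpha>)" for i and x :: "'i \<Rightarrow> complex"
  define S where "S x = (\<Sum>i\<in>I. cosh (X i x)) / card I" for x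
  define V where "V = (\<Sum>i\<in>I. \<Sum>j\<in>I. cosh (Re (\<Sum>\<alpha>\<in>\<Lambda>. v i \<alpha> * cnj (v j \<alpha>)) / 2)) / (card I)\<^sup>2"
  define e where "e = exp (s / 4)"
  have c: "card I > 0" using I by (simp add: card_gt_0_iff)
  have ee: "exp ((s + s) / 4) = e\<^sup>2"
    unfolding e_def power2_eq_square exp_add [symmetric] by (simp add: add_divide_distrib)
  have "has_bochner_integral (gaussian_family \<Lambda>) (\<lambda>x. \<Sum>i\<in>I. cosh (X i x)) (\<Sum>i\<in>I. e)"
  proof (intro has_bochner_integral_sum)
    fix i assume "i \<in> I"
    then show "has_bochner_integral (gaussian_family \<Lambda>) (\<lambda>x. cosh (X i x)) e"
      unfolding X_def e_def using gaussian_cosh_linear(1) [OF fin, of "v i"] by (simp only: v)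
  qed
  then have 1: "has_bochner_integral (gaussian_family \<Lambda>) S e"
    using has_bochner_integral_divide [of "gaussian_family \<Lambda>" "\<lambda>x. \<Sum>i\<in>I. cosh (X i x)" "\<Sum>i\<in>I. e" "real (card I)"] c
    by (simp add: S_def [abs_def])
  have prod: "has_bochner_integral (gaussian_family \<Lambda>) (\<lambda>x. \<Sum>i\<in>I. \<Sum>j\<in>I. cosh (X i x) * cosh (X j x))
      (\<Sum>i\<in>I. \<Sum>j\<in>I. e\<^sup>2 * cosh (Re (\<Sum>\<alpha>\<in>\<Lambda>. v i \<alpha> * cnj (v j \<alpha>)) / 2))"
  proof (intro has_bochner_integral_sum)
    fix i j assume "i \<in> I" "j \<in> I"
    then show "has_bochner_integral (gaussian_family \<Lambda>) (\<lambda>x. cosh (X i x) * cosh (X j x))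
        (e\<^sup>2 * cosh (Re (\<Sum>\<alpha>\<in>\<Lambda>. v i \<alpha> * cnj (v j \<alpha>)) / 2))"
      unfolding X_def using gaussian_cosh_linear(2) [OF fin, of "v i" "v j"] by (simp only: v ee)
  qed
  have 2: "has_bochner_integral (gaussian_family \<Lambda>) (\<lambda>x. (S x)\<^sup>2) (e\<^sup>2 * V)"
  proof -
    have "(S x)\<^sup>2 = (\<Sum>i\<in>I. \<Sum>j\<in>I. cosh (X i x) * cosh (X j x)) / (real (card I))\<^sup>2" for x
      unfolding S_def power_divide power2_eq_square [of "sum _ _"] sum_product ..
    moreover have "e\<^sup>2 * V = (\<Sum>i\<in>I. \<Sum>j\<in>I. e\<^sup>2 * cosh (Re (\<Sum>\<alpha>\<in>\<Lambda>. v i \<alpha> * cnj (v j \<alpha>)) / 2)) / (real (card I))\<^sup>2"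
      unfolding V_def by (simp only: sum_distrib_left times_divide_eq_right of_nat_power)
    ultimately show ?thesis
      using has_bochner_integral_divide [OF prod, of "(real (card I))\<^sup>2"] c by (simp only:)
  qed
  have ES: "expectation S = e" and int: "integrable (gaussian_family \<Lambda>) S" "integrable (gaussian_family \<Lambda>) (\<lambda>x. (S x)\<^sup>2)"
    and ES2: "expectation (\<lambda>x. (S x)\<^sup>2) = e\<^sup>2 * V"
    using 1 2 by (auto simp: has_bochner_integral_iff)
  have var: "variance S = e\<^sup>2 * (V - 1)"
    using variance_eq [OF int] by (simp add: ES ES2 algebra_simps)
  have e: "e > 0" by (simp add: e_def)
  have [measurable]: "S \<in> borel_measurable (gaussian_family \<Lambda>)"
    using int by (auto dest: borel_measurable_integrable)
  \<comment> \<open>Falling to half the mean is a deviation of at least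
    \<open>e / 2\<close>.\<close>
  have "prob {x \<in> space (gaussian_family \<Lambda>). S x \<le> e / 2} \<le> prob {x \<in> space (gaussian_family \<Lambda>). \<bar>S x - expectation S\<bar> \<ge> e / 2}"
  proof (rule finite_measure_mono)
    show "{x \<in> space (gaussian_family \<Lambda>). S x \<le> e / 2} \<subseteq> {x \<in> space (gaussian_family \<Lambda>). \<bar>S x - expectation S\<bar> \<ge> e / 2}"
      using e by (auto simp: ES abs_if)
  qed measurable
  also have "\<dots> \<le> variance S / (e / 2)\<^sup>2"
    using e int by (intro Chebyshev_inequality) auto
  also have "\<dots> = 4 * (V - 1)"
    using e unfolding var by (simp add: power_divide)
  finally show ?thesis
    by (simp add: S_def X_def V_def e_def)
qed

section \<open>Estimates for \<open>cosh\<close>, its Taylor series and its average over the torus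
  grid\<close>

lemma cosh_le_exp:
  fixes y c :: real
  assumes "\<bar>y\<bar> \<le> c"
  shows "cosh y \<le> exp c"
proof -
  have "exp y \<le> exp c" "exp (- y) \<le> exp c"
    using assms by auto
  then have "exp y + exp (- y) \<le> exp c + exp c"
    by (rule add_mono)
  then show ?thesis by (simp add: cosh_def)
qed

text \<open>The tail is compared term by term with the full series:
  \<open>fact (2 * k) * fact n \<le> fact (n + 2 * k)\<close>, and only even powers occur, so all
  terms are nonnegative.\<close>

lemma cosh_le_taylor:
  fixes y :: real
  shows "cosh y \<le> (\<Sum>i<k. y ^ (2 * i) / fact (2 * i)) + y ^ (2 * k) / fact (2 * k) * cosh y"
proof -
  define a where "a n = (if even n then y ^ n / fact n else 0)" for n :: nat
  have a: "a sums cosh y"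
    using cosh_converges [of y] by (simp add: a_def [abs_def] divide_inverse mult.commute cong: if_cong)
  have init: "(\<Sum>n<2 * k. a n) = (\<Sum>i<k. y ^ (2 * i) / fact (2 * i))"
    by (induction k) (simp_all add: a_def)
  have tail: "(\<lambda>n. a (n + 2 * k)) sums (cosh y - (\<Sum>n<2 * k. a n))"
    using a by (rule sums_split_initial_segment)
  have scaled: "(\<lambda>n. y ^ (2 * k) / fact (2 * k) * a n) sums (y ^ (2 * k) / fact (2 * k) * cosh y)"
    using a by (rule sums_mult)
  have le: "a (n + 2 * k) \<le> y ^ (2 * k) / fact (2 * k) * a n" for n
  proof (cases "even n")
    case True
    have "(fact (2 * k) * fact n :: real) \<le> fact (n + 2 * k)"
      using dvd_imp_le [OF fact_fact_dvd_fact [of "2 * k" n, where 'a = nat]]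
      by (metis add.commute fact_gt_zero of_nat_fact of_nat_le_iff of_nat_mult)
    then have "y ^ (n + 2 * k) / fact (n + 2 * k) \<le> y ^ (n + 2 * k) / (fact (2 * k) * fact n)"
      using True by (intro divide_left_mono) (auto simp: zero_le_even_power)
    then show ?thesis
      using True by (simp add: a_def power_add mult.commute)
  qed (simp add: a_def)
  have "cosh y - (\<Sum>n<2 * k. a n) \<le> y ^ (2 * k) / fact (2 * k) * cosh y"
    by (rule sums_le [OF le tail scaled])
  then show ?thesis by (simp add: init)
qed

text \<open>A single term of the exponential series at \<open>n\<close> is at most its sum
  \<open>exp n\<close>. This weak form of Stirling's bound suffices.\<close>

lemma fact_ge_power_exp: "(real n / exp 1) ^ n \<le> fact n"
proof -
  have "real n ^ n / fact n \<le> exp (real n)"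
  proof -
    have "(\<lambda>i. real n ^ i / fact i) sums exp (real n)"
      using exp_converges [of "real n"] by (simp add: divide_inverse mult.commute)
    then show ?thesis
      using sum_le_suminf [of "\<lambda>i. real n ^ i / fact i" "{n}"] by (simp add: sums_iff)
  qed
  then show ?thesis
    by (simp add: power_divide exp_of_nat_mult [symmetric] field_simps)
qed

lemma sum_power_from_1_le:
  fixes q :: real
  assumes "0 \<le> q" "q \<le> 1 / 2"
  shows "(\<Sum>i\<in>{1..k}. q ^ i) \<le> 2 * q"
proof -
  have eq: "(\<Sum>i\<in>{1..k}. q ^ i) = q * (\<Sum>i<k. q ^ i)"
    by (induction k) (simp_all add: distrib_left)
  have "(\<Sum>i<k. q ^ i) \<le> 2"
  proof -
    have "(\<Sum>i<k. q ^ i) = (1 - q ^ k) / (1 - q)"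
      using assms by (simp add: sum_gp_strict)
    also have "\<dots> \<le> 1 / (1 - q)"
      using assms by (intro divide_right_mono) auto
    also have "\<dots> \<le> 2" using assms by (simp add: field_simps)
    finally show ?thesis .
  qed
  then show ?thesis
    using mult_left_mono [of "\<Sum>i<k. q ^ i" 2 q] assms eq by simp
qed

text \<open>
  In the Taylor expansion of \<open>cosh\<close> the moments of order \<open>2 i\<close> with \<open>i \<le> T / 2\<close> contribute a geometric
  series with ratio of order \<open>2 ^ (- m)\<close>, because \<open>(i / T) ^ m\<close> is small; all higher orders are absorbed
  in the Taylor remainder. For \<open>T < 2\<close> the second moment alone suffices and gives \<open>1 / N\<close>.
\<close>

lemma torus_cosh_average:
  fixes A :: real
  assumes m: "m \<ge> 2" and \<Lambda>: "\<Lambda> \<subseteq> multiindices m n" "finite \<Lambda>" "\<Lambda> \<noteq> {}" and A: "A \<ge> 1"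
    and q: "A\<^sup>2 * exp (2 * A) * (1 / 2) ^ (m - 2) \<le> 1 / 2"
  defines "N \<equiv> real (card \<Lambda>)"
  defines "T \<equiv> N powr (1 / m)"
  obtains L where "L > m"
    and "\<And>c. (\<And>\<alpha>. \<alpha> \<in> \<Lambda> \<Longrightarrow> cmod (c \<alpha>) \<le> 1) \<Longrightarrow>
      (\<Sum>g\<in>{..<n} \<rightarrow>\<^sub>E {..<L}. cosh (A * T / 2 * Re (\<Sum>\<alpha>\<in>\<Lambda>. c \<alpha> * monom_at n (torus_point L g) \<alpha>) / N)) / real (L ^ n)
      \<le> 1 + A\<^sup>2 * exp (2 * A) * (1 / N + 2 * (1 / 2) ^ (m - 2))"
proof -
  have N: "N \<ge> 1" using \<Lambda> by (simp add: N_def Suc_le_eq card_gt_0_iff)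
  have T: "T \<ge> 1" unfolding T_def using N by (simp add: ge_one_powr_ge_zero)
  have TN: "T ^ m = N"
    using N m by (simp add: T_def powr_powr flip: powr_realpow')
  \<comment> \<open>Orders up to \<open>T / 2\<close> keep \<open>i / T \<le> 1 / 2\<close>. For
    \<open>T < 2\<close> rounding down would give 0 and a vacuous Taylor bound, so order 1 is used
    instead.\<close>
  define k where "k = (if T < 2 then 1 else nat \<lfloor>T / 2\<rfloor>)"
  have k: "k \<ge> 1"
    by (auto simp: k_def le_nat_floor)
  \<comment> \<open>The smallest grid size for which the moment bound holds for all orders up to
    \<open>k\<close>.\<close>
  define L where "L = m * k + 1"
  have L: "m < L" using k m by (cases k) (auto simp: L_def)
  define s where "s = A * T"
  have s: "s > 0" using A T by (simp add: s_def)
  \<comment> \<open>The bound for the grid average of the \<open>i\<close>-th even Taylor term,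
    obtained by inserting the moment estimate of order \<open>2 * i\<close>.\<close>
  define t where "t i = (s / (2 * N)) ^ (2 * i) / fact (2 * i) * (real (i ^ (m * i)) * N ^ i)" for i
  have t_le: "t i \<le> (A\<^sup>2 * (real i / T) ^ (m - 2)) ^ i" if "i \<ge> 1" for i
  proof -
    have "t i = ((s / (2 * N))\<^sup>2 * (real i ^ m * N)) ^ i / fact (2 * i)"
      by (simp add: t_def power_mult power_mult_distrib)
    also have "\<dots> = (s\<^sup>2 * real i ^ m / (4 * N)) ^ i / fact (2 * i)"
    proof -
      have "(s / (2 * N))\<^sup>2 * (real i ^ m * N) = s\<^sup>2 * real i ^ m / (4 * N)"
        using N by (simp add: power2_eq_square field_simps)
      then show ?thesis by (simp only:)
    qed
    also have "\<dots> \<le> (s\<^sup>2 * real i ^ m / (4 * N)) ^ i / (real (2 * i) / exp 1) ^ (2 * i)"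
      using N that fact_ge_power_exp [of "2 * i"] by (intro divide_left_mono) auto
    also have "\<dots> = (s\<^sup>2 * real i ^ m / (4 * N) / (real (2 * i) / exp 1)\<^sup>2) ^ i"
      by (simp only: power_mult power_divide [symmetric])
    also have "\<dots> \<le> (A\<^sup>2 * (real i / T) ^ (m - 2)) ^ i"
    proof (rule power_mono)
      \<comment> \<open>Here \<open>P\<close> and \<open>R\<close> stand for the powers
        \<open>m - 2\<close> of \<open>T\<close> and \<open>i\<close>. With
        \<open>T ^ m = N\<close>, two factors \<open>T\<close> cancel those in
        \<open>s\<^sup>2\<close> and two factors \<open>i\<close> cancel those from the factorial
        bound. What remains is \<open>(exp 1)\<^sup>2 / 16\<close>, which is below 1.\<close>
      have gen: "(A * T)\<^sup>2 * (R * j\<^sup>2) / (4 * (P * T\<^sup>2)) / (2 * j / e)\<^sup>2 = A\<^sup>2 * (R / P) * (e\<^sup>2 / 16)"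
        if "P > 0" "j > 0" "e > 0" for P R e j :: real
        using that T by (simp add: power2_eq_square field_simps)
      have m2: "T ^ m = T ^ (m - 2) * T\<^sup>2" "real i ^ m = real i ^ (m - 2) * (real i)\<^sup>2"
        using m by (simp_all only: power_add [symmetric] le_add_diff_inverse2)
      have "s\<^sup>2 * real i ^ m / (4 * N) / (real (2 * i) / exp 1)\<^sup>2 = A\<^sup>2 * (real i / T) ^ (m - 2) * ((exp 1)\<^sup>2 / 16)"
        unfolding TN [symmetric] m2 s_def power_divide [of "real i" T] of_nat_mult of_nat_numeral
        using T that by (intro gen) auto
      also have "\<dots> \<le> A\<^sup>2 * (real i / T) ^ (m - 2) * 1"
      proof (intro mult_left_mono)
        have "(exp 1)\<^sup>2 \<le> (3 :: real)\<^sup>2" using exp_le by (intro power_mono) auto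
        then show "(exp 1)\<^sup>2 / 16 \<le> (1 :: real)" by simp
      qed (use T in auto)
      finally show "s\<^sup>2 * real i ^ m / (4 * N) / (real (2 * i) / exp 1)\<^sup>2 \<le> A\<^sup>2 * (real i / T) ^ (m - 2)" by simp
    qed (use N in auto)
    finally show ?thesis .
  qed
  have bound: "(\<Sum>i\<in>{1..<k}. t i) + t k * exp (s / 2) \<le> A\<^sup>2 * exp (2 * A) * (1 / N + 2 * (1 / 2) ^ (m - 2))"
  proof (cases "T < 2")
    case True
    have "t 1 * exp (s / 2) \<le> A\<^sup>2 * (1 / N) * exp (2 * A)"
    proof (intro mult_mono)
      have "t 1 = A\<^sup>2 * T\<^sup>2 / 8 / N"
        using N by (simp add: t_def s_def power_divide power_mult_distrib power2_eq_square field_simps)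
      also have "\<dots> \<le> A\<^sup>2 * 1 / N"
      proof (intro divide_right_mono)
        have "T\<^sup>2 \<le> 2\<^sup>2" using True T by (intro power_mono) auto
        then have "A\<^sup>2 * T\<^sup>2 \<le> A\<^sup>2 * 8" by (intro mult_left_mono) auto
        then show "A\<^sup>2 * T\<^sup>2 / 8 \<le> A\<^sup>2 * 1" by simp
      qed (use N in auto)
      finally show "t 1 \<le> A\<^sup>2 * (1 / N)" by simp
      have "A * T \<le> A * 4" using True A by (intro mult_left_mono) auto
      then show "exp (s / 2) \<le> exp (2 * A)" by (simp add: s_def)
    qed (use N in auto)
    also have "\<dots> \<le> A\<^sup>2 * exp (2 * A) * (1 / N + 2 * (1 / 2) ^ (m - 2))"
      by (simp add: distrib_left)
    finally show ?thesis using True by (simp add: k_def)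
  next
    case False
    then have kf: "k = nat \<lfloor>T / 2\<rfloor>" by (simp add: k_def)
    have kT: "real k \<le> T / 2" "T / 2 < real k + 1"
      using T unfolding kf by linarith+
    \<comment> \<open>The factor \<open>exp (2 * A)\<close> is built into the ratio so that its
      \<open>k\<close>-th power absorbs the remainder factor \<open>exp (s / 2)\<close>. The
      hypothesis on \<open>A\<close> and \<open>m\<close> says that
      \<open>p \<le> 1 / 2\<close>.\<close>
    define p where "p = A\<^sup>2 * exp (2 * A) * (1 / 2) ^ (m - 2)"
    have le: "A\<^sup>2 * (real i / T) ^ (m - 2) \<le> A\<^sup>2 * (1 / 2) ^ (m - 2)" if "i \<le> k" for i
    proof (intro mult_left_mono power_mono)
      show "real i / T \<le> 1 / 2" using that kT T by (simp add: field_simps)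
    qed (use T in auto)
    have ti: "t i \<le> (A\<^sup>2 * (1 / 2) ^ (m - 2)) ^ i" if "1 \<le> i" "i \<le> k" for i
      using le [OF that(2)] T by (intro order_trans [OF t_le [OF that(1)]] power_mono) auto
    have "(\<Sum>i\<in>{1..<k}. t i) + t k * exp (s / 2) \<le> (\<Sum>i\<in>{1..<k}. p ^ i) + p ^ k"
    proof (intro add_mono sum_mono)
      fix i assume i: "i \<in> {1..<k}"
      have "A\<^sup>2 * 1 * (1 / 2) ^ (m - 2) \<le> p"
        unfolding p_def using A by (intro mult_right_mono mult_left_mono) auto
      then have "(A\<^sup>2 * (1 / 2) ^ (m - 2)) ^ i \<le> p ^ i"
        by (intro power_mono) auto
      then show "t i \<le> p ^ i" using ti [of i] i by auto
    next
      have "s / 2 \<le> real k * (2 * A)"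
      proof -
        \<comment> \<open>From \<open>T / 2 < k + 1\<close> and \<open>1 \<le> k\<close>, hence
          \<open>k + 1 \<le> 2 * k\<close>.\<close>
        have "T \<le> 4 * real k" using kT k False by linarith
        then have "A * T \<le> A * (4 * real k)" using A by (intro mult_left_mono) auto
        then show ?thesis by (simp add: s_def mult.commute)
      qed
      then have "exp (s / 2) \<le> exp (2 * A) ^ k"
        unfolding exp_of_nat_mult [symmetric] by simp
      then have "t k * exp (s / 2) \<le> (A\<^sup>2 * (1 / 2) ^ (m - 2)) ^ k * exp (2 * A) ^ k"
        using ti [of k] k by (intro mult_mono) auto
      also have "\<dots> = p ^ k"
        unfolding p_def power_mult_distrib [symmetric] by (simp only: mult_ac)
      finally show "t k * exp (s / 2) \<le> p ^ k" .
    qed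
    also have "\<dots> = (\<Sum>i\<in>{1..k}. p ^ i)"
      using k by (simp add: sum.last_plus add.commute)
    also have "\<dots> \<le> 2 * p"
      using q by (intro sum_power_from_1_le) (auto simp: p_def)
    also have "\<dots> \<le> A\<^sup>2 * exp (2 * A) * (1 / N + 2 * (1 / 2) ^ (m - 2))"
      using N by (simp add: p_def distrib_left)
    finally show ?thesis .
  qed
  show ?thesis
  proof (rule that [OF L])
    fix c assume c: "\<And>\<alpha>. \<alpha> \<in> \<Lambda> \<Longrightarrow> cmod (c \<alpha>) \<le> 1"
    let ?G = "{..<n} \<rightarrow>\<^sub>E {..<L}"
    define Q where "Q g = (\<Sum>\<alpha>\<in>\<Lambda>. c \<alpha> * monom_at n (torus_point L g) \<alpha>)" for g
    have QN: "cmod (Q g) \<le> N" for g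
    proof -
      have "cmod (Q g) \<le> (\<Sum>\<alpha>\<in>\<Lambda>. 1)"
        unfolding Q_def using c by (intro sum_norm_le) (simp add: norm_mult)
      then show ?thesis by (simp add: N_def)
    qed
    define M where "M i = (\<Sum>g\<in>?G. cmod (Q g) ^ (2 * i))" for i
    have M: "M i \<le> real (L ^ n) * (real (i ^ (m * i)) * N ^ i)" if "i \<le> k" for i
    proof -
      have "m * i < L" using that by (simp add: L_def less_Suc_eq_le)
      then show ?thesis
        using torus_moment_le [OF \<Lambda>(1,2), where c = c and k = i and L = L] c by (simp add: M_def Q_def N_def)
    qed
    define y where "y g = s / 2 * Re (Q g) / N" for g
    have ye: "(y g) ^ (2 * i) \<le> (s / (2 * N)) ^ (2 * i) * cmod (Q g) ^ (2 * i)" for g i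
    proof -
      have "\<bar>y g\<bar> = s / (2 * N) * \<bar>Re (Q g)\<bar>"
        using s N by (simp add: y_def abs_mult)
      also have "\<dots> \<le> s / (2 * N) * cmod (Q g)"
        using s N abs_Re_le_cmod by (intro mult_left_mono) auto
      finally have "\<bar>y g\<bar> ^ (2 * i) \<le> (s / (2 * N) * cmod (Q g)) ^ (2 * i)"
        by (intro power_mono) auto
      then show ?thesis
        unfolding power_mult_distrib by (subst (asm) power_even_abs) simp_all
    qed
    have cosh_y: "cosh (y g) \<le> exp (s / 2)" for g
    proof -
      have "\<bar>y g\<bar> = s / (2 * N) * \<bar>Re (Q g)\<bar>"
        using s N by (simp add: y_def abs_mult)
      also have "\<dots> \<le> s / (2 * N) * N"
        using s N order_trans [OF abs_Re_le_cmod QN] by (intro mult_left_mono) auto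
      finally have "\<bar>y g\<bar> \<le> s / 2" using N by simp
      then show ?thesis by (rule cosh_le_exp)
    qed
    define u where "u i = (s / (2 * N)) ^ (2 * i) / fact (2 * i)" for i
    have u: "u i \<ge> 0" for i using s N by (simp add: u_def)
    \<comment> \<open>The zeroth Taylor term gives the 1. In the remainder,
      \<open>cosh (y g)\<close> is replaced by its uniform bound \<open>exp (s / 2)\<close>, which
      leaves only the even moment of order \<open>2 * k\<close>.\<close>
    have "cosh (y g) \<le> 1 + (\<Sum>i\<in>{1..<k}. u i * cmod (Q g) ^ (2 * i)) + u k * exp (s / 2) * cmod (Q g) ^ (2 * k)" for g
    proof -
      have "cosh (y g) \<le> (\<Sum>i<k. y g ^ (2 * i) / fact (2 * i)) + y g ^ (2 * k) / fact (2 * k) * cosh (y g)"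
        by (rule cosh_le_taylor)
      also have "(\<Sum>i<k. y g ^ (2 * i) / fact (2 * i)) = 1 + (\<Sum>i\<in>{1..<k}. y g ^ (2 * i) / fact (2 * i))"
        using k unfolding lessThan_atLeast0 by (subst sum.atLeast_Suc_lessThan) simp_all
      also have "(\<Sum>i\<in>{1..<k}. y g ^ (2 * i) / fact (2 * i)) \<le> (\<Sum>i\<in>{1..<k}. u i * cmod (Q g) ^ (2 * i))"
      proof (intro sum_mono)
        fix i
        show "y g ^ (2 * i) / fact (2 * i) \<le> u i * cmod (Q g) ^ (2 * i)"
          using divide_right_mono [OF ye [of g i], of "fact (2 * i)"] by (simp add: u_def)
      qed
      also have "y g ^ (2 * k) / fact (2 * k) * cosh (y g) \<le> u k * cmod (Q g) ^ (2 * k) * exp (s / 2)"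
        using divide_right_mono [OF ye [of g k], of "fact (2 * k)"] cosh_y [of g] u [of k]
        by (intro mult_mono) (auto simp: u_def)
      finally show ?thesis by (simp add: mult_ac)
    qed
    then have "(\<Sum>g\<in>?G. cosh (y g))
        \<le> (\<Sum>g\<in>?G. 1 + (\<Sum>i\<in>{1..<k}. u i * cmod (Q g) ^ (2 * i)) + u k * exp (s / 2) * cmod (Q g) ^ (2 * k))"
      by (intro sum_mono)
    also have "\<dots> = real (L ^ n) + (\<Sum>i\<in>{1..<k}. u i * M i) + u k * exp (s / 2) * M k"
    proof -
      have "(\<Sum>g\<in>?G. \<Sum>i\<in>{1..<k}. u i * cmod (Q g) ^ (2 * i)) = (\<Sum>i\<in>{1..<k}. u i * M i)"
        unfolding M_def sum_distrib_left by (rule sum.swap)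
      moreover have "(\<Sum>g\<in>?G. 1) = real (L ^ n)"
        by (simp add: card_PiE)
      ultimately show ?thesis
        unfolding sum.distrib by (simp only: M_def sum_distrib_left)
    qed
    also have "\<dots> \<le> real (L ^ n) + (\<Sum>i\<in>{1..<k}. u i * (real (L ^ n) * (real (i ^ (m * i)) * N ^ i)))
        + u k * exp (s / 2) * (real (L ^ n) * (real (k ^ (m * k)) * N ^ k))"
    proof (intro add_mono sum_mono mult_left_mono order_refl)
      show "M i \<le> real (L ^ n) * (real (i ^ (m * i)) * N ^ i)" if "i \<in> {1..<k}" for i
        using that by (intro M) simp
      show "M k \<le> real (L ^ n) * (real (k ^ (m * k)) * N ^ k)"
        by (intro M) simp
    qed (use u in simp_all)
    also have "\<dots> = real (L ^ n) * (1 + ((\<Sum>i\<in>{1..<k}. t i) + t k * exp (s / 2)))"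
    proof -
      have "u i * (real (L ^ n) * (real (i ^ (m * i)) * N ^ i)) = real (L ^ n) * t i" for i
        unfolding t_def u_def by (simp only: mult_ac)
      then have "(\<Sum>i\<in>{1..<k}. u i * (real (L ^ n) * (real (i ^ (m * i)) * N ^ i))) = real (L ^ n) * (\<Sum>i\<in>{1..<k}. t i)"
        by (simp only: sum_distrib_left)
      moreover have "u k * exp (s / 2) * (real (L ^ n) * (real (k ^ (m * k)) * N ^ k)) = real (L ^ n) * (t k * exp (s / 2))"
        unfolding t_def u_def by (simp only: mult_ac)
      ultimately show ?thesis by (simp only: distrib_left mult_1_right add.assoc)
    qed
    also have "\<dots> \<le> real (L ^ n) * (1 + A\<^sup>2 * exp (2 * A) * (1 / N + 2 * (1 / 2) ^ (m - 2)))"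
      using bound by (intro mult_left_mono) auto
    finally have *: "(\<Sum>g\<in>?G. cosh (y g)) \<le> real (L ^ n) * (1 + A\<^sup>2 * exp (2 * A) * (1 / N + 2 * (1 / 2) ^ (m - 2)))" .
    show "(\<Sum>g\<in>?G. cosh (A * T / 2 * Re (\<Sum>\<alpha>\<in>\<Lambda>. c \<alpha> * monom_at n (torus_point L g) \<alpha>) / N)) / real (L ^ n)
        \<le> 1 + A\<^sup>2 * exp (2 * A) * (1 / N + 2 * (1 / 2) ^ (m - 2))"
    proof -
      have "real (L ^ n) > 0" using L by simp
      then have "(\<Sum>g\<in>?G. cosh (y g)) / real (L ^ n) \<le> 1 + A\<^sup>2 * exp (2 * A) * (1 / N + 2 * (1 / 2) ^ (m - 2))"
        using * by (simp only: pos_divide_le_eq mult.commute)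
      then show ?thesis by (simp only: y_def Q_def s_def)
    qed
  qed
qed

section \<open>The Bohnenblust--Hille quotient on the sphere\<close>

lemma finite_multiindices: "finite (multiindices m n)"
proof (rule finite_subset)
  show "multiindices m n \<subseteq> {..<n} \<rightarrow>\<^sub>E {..m}"
  proof
    fix \<alpha> assume \<alpha>: "\<alpha> \<in> multiindices m n"
    have "\<alpha> j \<le> m" if "j < n" for j
      using \<alpha> member_le_sum [of j "{..<n}" \<alpha>] that by (auto simp: multiindices_def)
    then show "\<alpha> \<in> {..<n} \<rightarrow>\<^sub>E {..m}"
      using \<alpha> by (auto simp: multiindices_def PiE_iff)
  qed
qed (auto intro: finite_PiE)

lemma hpoly_eq_monom: "hpoly n \<Lambda> a z = (\<Sum>\<alpha>\<in>\<Lambda>. a \<alpha> * monom_at n z \<alpha>)"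
  by (simp add: hpoly_def monom_at_def)

lemma norm_monom_le_1:
  assumes "\<And>j. j < n \<Longrightarrow> cmod (z j) \<le> 1"
  shows "cmod (monom_at n z \<alpha>) \<le> 1"
  unfolding monom_at_def prod_norm [symmetric]
  using assms by (intro prod_le_1) (auto simp: norm_power power_le_one)

lemma norm_hpoly_le_sum:
  assumes "z \<in> polydisc n"
  shows "cmod (hpoly n \<Lambda> a z) \<le> (\<Sum>\<alpha>\<in>\<Lambda>. cmod (a \<alpha>))"
  unfolding hpoly_eq_monom
proof (rule sum_norm_le)
  fix \<alpha>
  have "cmod (z j) \<le> 1" if "j < n" for j
    using assms that by (auto simp: polydisc_def PiE_iff less_imp_le)
  then show "cmod (a \<alpha> * monom_at n z \<alpha>) \<le> cmod (a \<alpha>)"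
    using norm_monom_le_1 [of n z \<alpha>] by (simp add: norm_mult mult_left_le)
qed

lemma bdd_above_hpoly: "bdd_above ((\<lambda>z. cmod (hpoly n \<Lambda> a z)) ` polydisc n)"
  using norm_hpoly_le_sum by (intro bdd_aboveI2)

lemma polydisc_nonempty: "polydisc n \<noteq> {}"
  by (simp add: polydisc_def PiE_eq_empty_iff)

lemma hpoly_norm_le_sum: "hpoly_norm n \<Lambda> a \<le> (\<Sum>\<alpha>\<in>\<Lambda>. cmod (a \<alpha>))"
  unfolding hpoly_norm_def using polydisc_nonempty norm_hpoly_le_sum by (rule cSUP_least)

text \<open>
  The supremum runs over the open polydisc; by homogeneity \<open>P (r z) = r\<^sup>m P z\<close>, and \<open>r \<rightarrow> 1\<close>
  reaches the torus.
\<close>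

lemma norm_hpoly_torus_le:
  assumes \<Lambda>: "\<Lambda> \<subseteq> multiindices m n" and z: "\<And>j. j < n \<Longrightarrow> cmod (z j) \<le> 1"
  shows "cmod (hpoly n \<Lambda> a z) \<le> hpoly_norm n \<Lambda> a"
proof -
  let ?c = "cmod (hpoly n \<Lambda> a z)"
  have le: "r ^ m * ?c \<le> hpoly_norm n \<Lambda> a" if r: "0 < r" "r < 1" for r :: real
  proof -
    define w where "w = (\<lambda>j\<in>{..<n}. complex_of_real r * z j)"
    have "r * cmod (z j) < 1" if "j < n" for j
    proof -
      have "r * cmod (z j) \<le> r * 1"
        using z [OF that] r by (intro mult_left_mono) auto
      then show ?thesis using r by linarith
    qed
    then have w: "w \<in> polydisc n"
      using r by (simp add: w_def polydisc_def norm_mult)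
    have "monom_at n w \<alpha> = complex_of_real r ^ m * monom_at n z \<alpha>" if "\<alpha> \<in> \<Lambda>" for \<alpha>
    proof -
      have "monom_at n w \<alpha> = (\<Prod>j<n. complex_of_real r ^ \<alpha> j) * monom_at n z \<alpha>"
        by (simp add: monom_at_def w_def power_mult_distrib prod.distrib)
      also have "(\<Prod>j<n. complex_of_real r ^ \<alpha> j) = complex_of_real r ^ (\<Sum>j<n. \<alpha> j)"
        by (simp only: power_sum)
      also have "(\<Sum>j<n. \<alpha> j) = m"
        using \<Lambda> that by (auto simp: multiindices_def)
      finally show ?thesis .
    qed
    then have "hpoly n \<Lambda> a w = complex_of_real r ^ m * hpoly n \<Lambda> a z"
      unfolding hpoly_eq_monom sum_distrib_left by (intro sum.cong) (auto simp: mult_ac)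
    then have "cmod (hpoly n \<Lambda> a w) = r ^ m * ?c"
      using r by (simp add: norm_mult norm_power)
    moreover have "cmod (hpoly n \<Lambda> a w) \<le> hpoly_norm n \<Lambda> a"
      unfolding hpoly_norm_def using bdd_above_hpoly w by (intro cSUP_upper)
    ultimately show ?thesis by simp
  qed
  show ?thesis
  proof (rule tendsto_upperbound)
    have "((\<lambda>r. r ^ m * ?c) \<longlongrightarrow> 1 ^ m * ?c) (at_left (1 :: real))"
      by (intro tendsto_intros)
    then show "((\<lambda>r. r ^ m * ?c) \<longlongrightarrow> ?c) (at_left (1 :: real))" by simp
    have "eventually (\<lambda>r :: real. r \<in> {0<..<1}) (at_left 1)"
      by (rule eventually_at_left_real) simp
    then show "eventually (\<lambda>r. r ^ m * ?c \<le> hpoly_norm n \<Lambda> a) (at_left (1 :: real))"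
      by eventually_elim (use le in auto)
  qed simp
qed

lemma norm_torus_point [simp]: "cmod (torus_point L g j) = 1"
  by (simp add: torus_point_def)

text \<open>All exponents are at most \<open>m < L\<close>, so distinct members of
  \<open>\<Lambda>\<close> are orthogonal on the grid. This identity serves to show that a
  polynomial with coefficients on the sphere has positive sup norm.\<close>

lemma hpoly_parseval:
  assumes \<Lambda>: "\<Lambda> \<subseteq> multiindices m n" and L: "m < L"
  shows "(\<Sum>g\<in>{..<n} \<rightarrow>\<^sub>E {..<L}. (cmod (hpoly n \<Lambda> a (torus_point L g)))\<^sup>2) = real (L ^ n) * (\<Sum>\<alpha>\<in>\<Lambda>. (cmod (a \<alpha>))\<^sup>2)"
proof -
  let ?G = "{..<n} \<rightarrow>\<^sub>E {..<L}"
  have fin: "finite \<Lambda>" using \<Lambda> finite_multiindices finite_subset by blast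
  have less: "\<alpha> j < L" if "\<alpha> \<in> \<Lambda>" "j < n" for \<alpha> j
    using \<Lambda> that L member_le_sum [of j "{..<n}" \<alpha>] by (auto simp: multiindices_def)
  have eq: "\<alpha> = \<beta>" if "\<alpha> \<in> \<Lambda>" "\<beta> \<in> \<Lambda>" "\<forall>j<n. \<alpha> j = \<beta> j" for \<alpha> \<beta>
    using that \<Lambda> by (intro PiE_ext [of \<alpha> "{..<n}" "\<lambda>_. UNIV" \<beta>]) (auto simp: multiindices_def)
  have orth: "(\<Sum>g\<in>?G. monom_at n (torus_point L g) \<alpha> * cnj (monom_at n (torus_point L g) \<beta>))
      = (if \<alpha> = \<beta> then of_nat (L ^ n) else 0)" if "\<alpha> \<in> \<Lambda>" "\<beta> \<in> \<Lambda>" for \<alpha> \<beta>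
  proof -
    have "(\<forall>j<n. \<alpha> j = \<beta> j) \<longleftrightarrow> \<alpha> = \<beta>" using eq [OF that] by auto
    then show ?thesis
      using sum_torus_monom [of n \<alpha> L \<beta>] less that by simp
  qed
  have "complex_of_real (\<Sum>g\<in>?G. (cmod (hpoly n \<Lambda> a (torus_point L g)))\<^sup>2)
      = (\<Sum>g\<in>?G. \<Sum>\<alpha>\<in>\<Lambda>. \<Sum>\<beta>\<in>\<Lambda>. a \<alpha> * cnj (a \<beta>) * (monom_at n (torus_point L g) \<alpha> * cnj (monom_at n (torus_point L g) \<beta>)))"
    unfolding of_real_sum complex_norm_square hpoly_eq_monom cnj_sum sum_product
    by (intro sum.cong refl) (simp add: mult_ac)
  also have "\<dots> = (\<Sum>\<alpha>\<in>\<Lambda>. \<Sum>\<beta>\<in>\<Lambda>. a \<alpha> * cnj (a \<beta>) * (\<Sum>g\<in>?G. monom_at n (torus_point L g) \<alpha> * cnj (monom_at n (torus_point L g) \<beta>)))"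
    unfolding sum_distrib_left by (subst sum.swap, rule sum.cong [OF refl], rule sum.swap)
  also have "\<dots> = (\<Sum>\<alpha>\<in>\<Lambda>. \<Sum>\<beta>\<in>\<Lambda>. if \<alpha> = \<beta> then a \<alpha> * cnj (a \<alpha>) * of_nat (L ^ n) else 0)"
    by (intro sum.cong refl) (simp add: orth)
  also have "\<dots> = (\<Sum>\<alpha>\<in>\<Lambda>. a \<alpha> * cnj (a \<alpha>) * of_nat (L ^ n))"
    using fin by (intro sum.cong refl) simp
  also have "\<dots> = complex_of_real (real (L ^ n) * (\<Sum>\<alpha>\<in>\<Lambda>. (cmod (a \<alpha>))\<^sup>2))"
    unfolding of_real_mult of_real_sum complex_norm_square sum_distrib_left by (intro sum.cong refl) (simp add: mult_ac)
  finally show ?thesis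
    by (simp only: of_real_eq_iff)
qed

text \<open>Hoelder's inequality between the exponents \<open>bh_exponent m\<close> and 2, obtained
  by summing Young's inequality term by term.\<close>

lemma lp_norm_bh_exponent_le:
  assumes m: "m \<ge> 1" and fin: "finite \<Lambda>" "\<Lambda> \<noteq> {}" and a: "a \<in> unit_sphere \<Lambda>"
  shows "lp_norm (bh_exponent m) \<Lambda> a \<le> card \<Lambda> powr (1 / (2 * m))"
proof -
  define N where "N = real (card \<Lambda>)"
  have N: "N \<ge> 1" using fin by (simp add: N_def Suc_le_eq card_gt_0_iff)
  define q where "q = bh_exponent m"
  define \<theta> where "\<theta> = real m / (real m + 1)"
  have q: "q = 2 * \<theta>" by (simp add: q_def \<theta>_def bh_exponent_def)
  have \<theta>: "0 < \<theta>" "\<theta> \<le> 1" using m by (simp_all add: \<theta>_def)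
  have a2: "(\<Sum>\<alpha>\<in>\<Lambda>. (cmod (a \<alpha>))\<^sup>2) = 1"
    using a by (simp add: unit_sphere_def flip: lp_norm_2_power2)
  \<comment> \<open>The factor \<open>N\<close> normalizes the equality case, which is
    \<open>(cmod (a \<alpha>))\<^sup>2 = 1 / N\<close> for every index, so the summed bound is
    exactly \<open>N\<close>.\<close>
  have Young: "N powr \<theta> * cmod (a \<alpha>) powr q \<le> \<theta> * (N * (cmod (a \<alpha>))\<^sup>2) + (1 - \<theta>)" for \<alpha>
  proof (cases "a \<alpha> = 0")
    case False
    have "N powr \<theta> * cmod (a \<alpha>) powr q = (N * (cmod (a \<alpha>))\<^sup>2) powr \<theta> * 1 powr (1 - \<theta>)"
      using N False by (simp add: powr_mult q powr_powr [symmetric])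
    also have "\<dots> \<le> \<theta> * (N * (cmod (a \<alpha>))\<^sup>2) + (1 - \<theta>) * 1"
      using \<theta> N False by (intro Youngs_inequality_0) auto
    finally show ?thesis by simp
  qed (use \<theta> in simp)
  have "N powr \<theta> * (\<Sum>\<alpha>\<in>\<Lambda>. cmod (a \<alpha>) powr q) \<le> (\<Sum>\<alpha>\<in>\<Lambda>. \<theta> * (N * (cmod (a \<alpha>))\<^sup>2) + (1 - \<theta>))"
    unfolding sum_distrib_left using Young by (rule sum_mono)
  also have "\<dots> = \<theta> * N * (\<Sum>\<alpha>\<in>\<Lambda>. (cmod (a \<alpha>))\<^sup>2) + N * (1 - \<theta>)"
    by (simp add: sum.distrib N_def sum_distrib_left mult_ac)
  also have "\<dots> = N" by (simp add: a2 algebra_simps)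
  finally have "(\<Sum>\<alpha>\<in>\<Lambda>. cmod (a \<alpha>) powr q) \<le> N powr (1 - \<theta>)"
    using N by (simp add: powr_diff field_simps)
  then have "(\<Sum>\<alpha>\<in>\<Lambda>. cmod (a \<alpha>) powr q) powr (1 / q) \<le> (N powr (1 - \<theta>)) powr (1 / q)"
    using q \<theta> by (intro powr_mono2) (auto intro: sum_nonneg)
  also have "\<dots> = N powr ((1 - \<theta>) * (1 / q))"
    by (rule powr_powr)
  \<comment> \<open>Here \<open>1 - \<theta> = 1 / (m + 1)\<close> and
    \<open>q = 2 * m / (m + 1)\<close>; this is the source of the power \<open>1 / (2 * m)\<close>,
    that is, of \<open>sqrt T\<close>.\<close>
  also have "(1 - \<theta>) * (1 / q) = 1 / (2 * m)"
    using m by (simp add: q \<theta>_def divide_simps)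
  finally show ?thesis by (simp add: lp_norm_def q_def N_def)
qed

lemma unit_sphere_component_le_1:
  assumes "finite \<Lambda>" "a \<in> unit_sphere \<Lambda>" "\<alpha> \<in> \<Lambda>"
  shows "cmod (a \<alpha>) \<le> 1"
proof -
  have "(cmod (a \<alpha>))\<^sup>2 \<le> (\<Sum>\<alpha>\<in>\<Lambda>. (cmod (a \<alpha>))\<^sup>2)"
    using assms by (intro member_le_sum) auto
  also have "\<dots> = 1" using assms(2) by (simp add: unit_sphere_def flip: lp_norm_2_power2)
  finally show ?thesis by (simp add: power_le_one_iff)
qed

text \<open>The moduli are at most 1 and the exponent is at most 2, so the numerator is at least the
  Euclidean norm 1. The sup norm is at most the sum of the moduli, hence at most
  \<open>card \<Lambda>\<close>.\<close>

lemma bh_quotient_ge: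
  assumes m: "m \<ge> 1" and \<Lambda>: "\<Lambda> \<subseteq> multiindices m n" "\<Lambda> \<noteq> {}" and a: "a \<in> unit_sphere \<Lambda>"
  shows "bh_quotient m n \<Lambda> a \<ge> 1 / card \<Lambda>"
proof -
  have fin: "finite \<Lambda>" using \<Lambda> finite_multiindices finite_subset by blast
  have a2: "(\<Sum>\<alpha>\<in>\<Lambda>. (cmod (a \<alpha>))\<^sup>2) = 1"
    using a by (simp add: unit_sphere_def flip: lp_norm_2_power2)
  have le1: "cmod (a \<alpha>) \<le> 1" if "\<alpha> \<in> \<Lambda>" for \<alpha>
    using unit_sphere_component_le_1 [OF fin a that] .
  have nz: "\<not> (\<forall>\<alpha>\<in>\<Lambda>. a \<alpha> = 0)"
  proof
    assume "\<forall>\<alpha>\<in>\<Lambda>. a \<alpha> = 0"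
    then have "(\<Sum>\<alpha>\<in>\<Lambda>. (cmod (a \<alpha>))\<^sup>2) = 0" by simp
    with a2 show False by simp
  qed
  have q: "0 < bh_exponent m" "bh_exponent m \<le> 2"
    using m by (auto simp: bh_exponent_def divide_simps)
  have "1 = (\<Sum>\<alpha>\<in>\<Lambda>. (cmod (a \<alpha>))\<^sup>2)" by (simp add: a2)
  also have "\<dots> \<le> (\<Sum>\<alpha>\<in>\<Lambda>. cmod (a \<alpha>) powr bh_exponent m)"
  proof (rule sum_mono)
    fix \<alpha> assume "\<alpha> \<in> \<Lambda>"
    show "(cmod (a \<alpha>))\<^sup>2 \<le> cmod (a \<alpha>) powr bh_exponent m"
    proof (cases "a \<alpha> = 0")
      case False
      have "(cmod (a \<alpha>))\<^sup>2 = cmod (a \<alpha>) powr 2" using False by simp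
      also have "\<dots> \<le> cmod (a \<alpha>) powr bh_exponent m"
        using le1 [OF \<open>\<alpha> \<in> \<Lambda>\<close>] q False by (intro powr_mono') auto
      finally show ?thesis .
    qed simp
  qed
  finally have lp: "1 \<le> lp_norm (bh_exponent m) \<Lambda> a"
    unfolding lp_norm_def using q by (intro ge_one_powr_ge_zero) auto
  \<comment> \<open>Positivity matters because division by zero would make the quotient 0. By
    Parseval the polynomial is nonzero at some grid point.\<close>
  have "0 < hpoly_norm n \<Lambda> a"
  proof -
    have "(\<Sum>g\<in>{..<n} \<rightarrow>\<^sub>E {..<Suc m}. (cmod (hpoly n \<Lambda> a (torus_point (Suc m) g)))\<^sup>2) > 0"
      using hpoly_parseval [OF \<Lambda>(1), of "Suc m" a] by (simp add: a2)
    then obtain g where "hpoly n \<Lambda> a (torus_point (Suc m) g) \<noteq> 0"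
      by (metis (no_types, lifting) less_irrefl norm_zero sum.neutral zero_power2)
    then have "0 < cmod (hpoly n \<Lambda> a (torus_point (Suc m) g))" by simp
    also have "\<dots> \<le> hpoly_norm n \<Lambda> a"
      using \<Lambda>(1) by (rule norm_hpoly_torus_le) simp
    finally show ?thesis .
  qed
  moreover have "hpoly_norm n \<Lambda> a \<le> card \<Lambda>"
    using hpoly_norm_le_sum [of n \<Lambda> a] sum_mono [of \<Lambda> "\<lambda>\<alpha>. cmod (a \<alpha>)" "\<lambda>_. 1"] le1 by simp
  ultimately have "1 / card \<Lambda> \<le> lp_norm (bh_exponent m) \<Lambda> a / hpoly_norm n \<Lambda> a"
    using lp by (intro frac_le) auto
  then show ?thesis unfolding bh_quotient_def if_not_P [OF nz] .
qed

section \<open>The probability that the quotient exceeds a threshold\<close>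

lemma measurable_hpoly [measurable]:
  "(\<lambda>a. hpoly n \<Lambda> a z) \<in> borel_measurable (lebesgue_family \<Lambda>)"
  unfolding hpoly_def by measurable

lemma hpoly_radial:
  assumes "0 < lp_norm 2 \<Lambda> x"
  shows "hpoly n \<Lambda> x z = complex_of_real (lp_norm 2 \<Lambda> x) * hpoly n \<Lambda> (radial \<Lambda> x) z"
  unfolding hpoly_def sum_distrib_left using assms by (intro sum.cong refl) (simp add: radial_def)

text \<open>A large quotient forces all grid values below \<open>\<tau>\<close>, which is the event
  \<open>E\<close>. Lifted to Gaussian coefficients, \<open>E\<close> requires an unusually long
  vector (\<open>D\<close>) or an unusually small \<open>cosh\<close> average (\<open>C\<close>);
  the two summands of the bound belong to these two events.\<close>

lemma sphere_prob_bh_quotient_le: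
  assumes m: "m \<ge> 2" and \<Lambda>: "\<Lambda> \<subseteq> multiindices m n" "\<Lambda> \<noteq> {}" and \<epsilon>: "\<epsilon> > 0"
    and A: "A \<ge> 8" "A \<ge> 128 / \<epsilon>\<^sup>2"
    and q: "A\<^sup>2 * exp (2 * A) * (1 / 2) ^ (m - 2) \<le> 1 / 2"
  shows "measure (sphere_prob \<Lambda>) {a \<in> unit_sphere \<Lambda>. bh_quotient m n \<Lambda> a > \<epsilon>}
    \<le> (2 / exp 1) ^ card \<Lambda> + 4 * (A\<^sup>2 * exp (2 * A) * (1 / card \<Lambda> + 2 * (1 / 2) ^ (m - 2)))"
proof -
  have fin: "finite \<Lambda>" using \<Lambda> finite_multiindices finite_subset by blast
  define N where "N = real (card \<Lambda>)"
  have N: "N \<ge> 1" using fin \<Lambda> by (simp add: N_def Suc_le_eq card_gt_0_iff)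
  define T where "T = N powr (1 / m)"
  have T: "T \<ge> 1" unfolding T_def using N by (simp add: ge_one_powr_ge_zero)
  define s where "s = A * T"
  have s: "s > 0" using A T by (simp add: s_def)
  define B where "B = A\<^sup>2 * exp (2 * A) * (1 / N + 2 * (1 / 2) ^ (m - 2))"
  have "A \<ge> 1" using A by simp
  then obtain L where L: "L > m" and avg: "\<And>c. (\<And>\<alpha>. \<alpha> \<in> \<Lambda> \<Longrightarrow> cmod (c \<alpha>) \<le> 1) \<Longrightarrow>
      (\<Sum>g\<in>{..<n} \<rightarrow>\<^sub>E {..<L}. cosh (s / 2 * Re (\<Sum>\<alpha>\<in>\<Lambda>. c \<alpha> * monom_at n (torus_point L g) \<alpha>) / N)) / real (L ^ n) \<le> 1 + B"
    using torus_cosh_average [OF m \<Lambda>(1) fin \<Lambda>(2) _ q] unfolding B_def s_def T_def N_def by blast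
  let ?G = "{..<n} \<rightarrow>\<^sub>E {..<L}"
  have G: "finite ?G" "?G \<noteq> {}" "card ?G = L ^ n"
    using L by (auto simp: card_PiE PiE_eq_empty_iff intro!: finite_PiE)
  \<comment> \<open>Scaling the \<open>N\<close> unimodular monomial values by \<open>l\<close>
    makes the squared norm of every \<open>v g\<close> equal to \<open>s\<close>.\<close>
  define l where "l = sqrt (s / N)"
  have l2: "l\<^sup>2 = s / N" using s N by (simp add: l_def)
  have l: "l > 0" using s N by (simp add: l_def)
  define v where "v g \<alpha> = complex_of_real l * monom_at n (torus_point L g) \<alpha>" for g \<alpha>
  \<comment> \<open>With the numerator at most \<open>sqrt T\<close>, a quotient above
    \<open>\<epsilon>\<close> keeps the sup norm below this value.\<close>
  define \<tau> where "\<tau> = sqrt T / \<epsilon>"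
  define E where "E = {a \<in> unit_sphere \<Lambda>. \<forall>g\<in>?G. cmod (hpoly n \<Lambda> a (torus_point L g)) \<le> \<tau>}"
  define C where "C = {x \<in> \<Lambda> \<rightarrow>\<^sub>E UNIV. (\<Sum>g\<in>?G. cosh (Re (\<Sum>\<alpha>\<in>\<Lambda>. v g \<alpha> * x \<alpha>))) / card ?G \<le> exp (s / 4) / 2}"
  define D where "D = {x \<in> \<Lambda> \<rightarrow>\<^sub>E UNIV. (\<Sum>\<alpha>\<in>\<Lambda>. (cmod (x \<alpha>))\<^sup>2) \<ge> 2 * card \<Lambda>}"
  interpret G: prob_space "gaussian_family \<Lambda>" by (rule prob_space_gaussian_family [OF fin])
  interpret P: prob_space "sphere_prob \<Lambda>" by (rule prob_space_sphere_prob [OF fin \<Lambda>(2)])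
  have "{a \<in> space (lebesgue_family \<Lambda>). lp_norm 2 \<Lambda> a = 1 \<and> (\<forall>g\<in>?G. cmod (hpoly n \<Lambda> a (torus_point L g)) \<le> \<tau>)} \<in> sets (lebesgue_family \<Lambda>)"
    using G(1) by measurable
  also have "{a \<in> space (lebesgue_family \<Lambda>). lp_norm 2 \<Lambda> a = 1 \<and> (\<forall>g\<in>?G. cmod (hpoly n \<Lambda> a (torus_point L g)) \<le> \<tau>)} = E"
    by (auto simp: E_def unit_sphere_def space_lebesgue_family)
  finally have E: "E \<subseteq> unit_sphere \<Lambda>" "E \<in> sets (lebesgue_family \<Lambda>)"
    by (auto simp: E_def)
  have "{x \<in> space (lebesgue_family \<Lambda>). (\<Sum>g\<in>?G. cosh (Re (\<Sum>\<alpha>\<in>\<Lambda>. v g \<alpha> * x \<alpha>))) / card ?G \<le> exp (s / 4) / 2} \<in> sets (lebesgue_family \<Lambda>)"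
    unfolding cosh_def by measurable
  then have C: "C \<in> sets (gaussian_family \<Lambda>)" by (simp add: C_def space_lebesgue_family)
  have "{x \<in> space (lebesgue_family \<Lambda>). (\<Sum>\<alpha>\<in>\<Lambda>. (cmod (x \<alpha>))\<^sup>2) \<ge> 2 * card \<Lambda>} \<in> sets (lebesgue_family \<Lambda>)"
    by measurable
  then have D: "D \<in> sets (gaussian_family \<Lambda>)" by (simp add: D_def space_lebesgue_family)

  have PC: "G.prob C \<le> 4 * B"
  proof -
    have "G.prob C \<le> 4 * ((\<Sum>g\<in>?G. \<Sum>h\<in>?G. cosh (Re (\<Sum>\<alpha>\<in>\<Lambda>. v g \<alpha> * cnj (v h \<alpha>)) / 2)) / (card ?G)\<^sup>2 - 1)"
      unfolding C_def
    proof (rule gaussian_cosh_average [OF fin G(1,2)])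
      fix g
      show "(\<Sum>\<alpha>\<in>\<Lambda>. (cmod (v g \<alpha>))\<^sup>2) = s"
        using l N by (simp add: v_def norm_mult l2) (simp add: N_def)
    qed
    also have "(\<Sum>g\<in>?G. \<Sum>h\<in>?G. cosh (Re (\<Sum>\<alpha>\<in>\<Lambda>. v g \<alpha> * cnj (v h \<alpha>)) / 2)) / (card ?G)\<^sup>2 \<le> 1 + B"
    proof -
      \<comment> \<open>With \<open>h\<close> fixed, the conjugated monomial values at
        \<open>h\<close> are coefficients of modulus 1, so the covariances over \<open>g\<close> are
        values of one polynomial and the torus average applies.\<close>
      have "(\<Sum>g\<in>?G. cosh (Re (\<Sum>\<alpha>\<in>\<Lambda>. v g \<alpha> * cnj (v h \<alpha>)) / 2)) \<le> (1 + B) * real (L ^ n)" for h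
      proof -
        have Re_mult: "Re (complex_of_real r * z) = r * Re z" for r z
          by simp
        have "Re (\<Sum>\<alpha>\<in>\<Lambda>. v g \<alpha> * cnj (v h \<alpha>)) / 2
            = s / 2 * Re (\<Sum>\<alpha>\<in>\<Lambda>. cnj (monom_at n (torus_point L h) \<alpha>) * monom_at n (torus_point L g) \<alpha>) / N" for g
        proof -
          have "(\<Sum>\<alpha>\<in>\<Lambda>. v g \<alpha> * cnj (v h \<alpha>)) = complex_of_real (l\<^sup>2) * (\<Sum>\<alpha>\<in>\<Lambda>. cnj (monom_at n (torus_point L h) \<alpha>) * monom_at n (torus_point L g) \<alpha>)"
            unfolding sum_distrib_left v_def by (intro sum.cong refl) (simp add: power2_eq_square mult_ac)
          then have "Re (\<Sum>\<alpha>\<in>\<Lambda>. v g \<alpha> * cnj (v h \<alpha>)) = l\<^sup>2 * Re (\<Sum>\<alpha>\<in>\<Lambda>. cnj (monom_at n (torus_point L h) \<alpha>) * monom_at n (torus_point L g) \<alpha>)"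
            by (simp only: Re_mult)
          then show ?thesis by (simp only: l2) simp
        qed
        then have "(\<Sum>g\<in>?G. cosh (Re (\<Sum>\<alpha>\<in>\<Lambda>. v g \<alpha> * cnj (v h \<alpha>)) / 2)) / real (L ^ n) \<le> 1 + B"
          using avg [of "\<lambda>\<alpha>. cnj (monom_at n (torus_point L h) \<alpha>)"] by (simp only: complex_mod_cnj norm_monom_torus_point order_refl)
        moreover have "real (L ^ n) > 0" using L by simp
        ultimately show ?thesis by (simp only: pos_divide_le_eq)
      qed
      then have "(\<Sum>h\<in>?G. \<Sum>g\<in>?G. cosh (Re (\<Sum>\<alpha>\<in>\<Lambda>. v g \<alpha> * cnj (v h \<alpha>)) / 2)) \<le> (\<Sum>h\<in>?G. (1 + B) * real (L ^ n))"
        by (intro sum_mono)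
      also have "\<dots> = (1 + B) * real ((card ?G)\<^sup>2)"
        by (simp add: G(3) power2_eq_square)
      finally show ?thesis
        using L by (subst sum.swap) (simp add: G(3) pos_divide_le_eq)
    qed
    finally show ?thesis by simp
  qed

  have sub1: "{a \<in> unit_sphere \<Lambda>. bh_quotient m n \<Lambda> a > \<epsilon>} \<subseteq> E"
  proof
    fix a assume "a \<in> {a \<in> unit_sphere \<Lambda>. bh_quotient m n \<Lambda> a > \<epsilon>}"
    then have a: "a \<in> unit_sphere \<Lambda>" and R: "bh_quotient m n \<Lambda> a > \<epsilon>" by auto
    have quot: "\<epsilon> < lp_norm (bh_exponent m) \<Lambda> a / hpoly_norm n \<Lambda> a"
      using R \<epsilon> by (auto simp: bh_quotient_def split: if_splits)
    have le: "cmod (hpoly n \<Lambda> a (torus_point L g)) \<le> hpoly_norm n \<Lambda> a" for g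
      using \<Lambda>(1) by (rule norm_hpoly_torus_le) simp
    have "0 \<le> hpoly_norm n \<Lambda> a"
      using le [of undefined] norm_ge_zero order_trans by blast
    \<comment> \<open>A zero norm would make the quotient 0 by the convention for division,
      contradicting \<open>\<epsilon> > 0\<close>.\<close>
    moreover have "hpoly_norm n \<Lambda> a \<noteq> 0" using quot \<epsilon> by auto
    ultimately have pos: "hpoly_norm n \<Lambda> a > 0" by simp
    have "sqrt T = N powr (1 / (2 * m))"
      unfolding T_def powr_half_sqrt [symmetric, OF powr_ge_zero] powr_powr by (simp add: mult.commute)
    then have "lp_norm (bh_exponent m) \<Lambda> a \<le> sqrt T"
      using lp_norm_bh_exponent_le [OF _ fin \<Lambda>(2) a, of m] m by (simp add: N_def)
    moreover have "\<epsilon> * hpoly_norm n \<Lambda> a < lp_norm (bh_exponent m) \<Lambda> a"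
      using quot pos by (simp add: pos_less_divide_eq)
    ultimately have "\<epsilon> * hpoly_norm n \<Lambda> a \<le> sqrt T" by linarith
    then have "hpoly_norm n \<Lambda> a \<le> \<tau>"
      using \<epsilon> by (simp add: \<tau>_def pos_le_divide_eq mult.commute)
    then show "a \<in> E"
      using a le order_trans by (auto simp: E_def)
  qed

  have sub2: "{x \<in> \<Lambda> \<rightarrow>\<^sub>E UNIV. 0 < lp_norm 2 \<Lambda> x \<and> radial \<Lambda> x \<in> E} \<subseteq> D \<union> C"
  proof
    fix x assume "x \<in> {x \<in> \<Lambda> \<rightarrow>\<^sub>E UNIV. 0 < lp_norm 2 \<Lambda> x \<and> radial \<Lambda> x \<in> E}"
    then have x: "x \<in> \<Lambda> \<rightarrow>\<^sub>E UNIV" "0 < lp_norm 2 \<Lambda> x" "radial \<Lambda> x \<in> E" by auto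
    show "x \<in> D \<union> C"
    proof (cases "x \<in> D")
      case False
      then have "(lp_norm 2 \<Lambda> x)\<^sup>2 \<le> 2 * N"
        using x by (simp add: D_def lp_norm_2_power2 N_def)
      then have nx: "lp_norm 2 \<Lambda> x \<le> sqrt (2 * N)"
        by (rule real_le_rsqrt)
      have "cosh (Re (\<Sum>\<alpha>\<in>\<Lambda>. v g \<alpha> * x \<alpha>)) \<le> exp (s / 4) / 2" if "g \<in> ?G" for g
      proof -
        have "(\<Sum>\<alpha>\<in>\<Lambda>. v g \<alpha> * x \<alpha>) = complex_of_real l * hpoly n \<Lambda> x (torus_point L g)"
          unfolding hpoly_eq_monom sum_distrib_left v_def by (intro sum.cong refl) (simp add: mult_ac)
        then have "\<bar>Re (\<Sum>\<alpha>\<in>\<Lambda>. v g \<alpha> * x \<alpha>)\<bar> \<le> cmod (complex_of_real l * hpoly n \<Lambda> x (torus_point L g))"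
          by (metis abs_Re_le_cmod)
        also have "\<dots> = l * (lp_norm 2 \<Lambda> x * cmod (hpoly n \<Lambda> (radial \<Lambda> x) (torus_point L g)))"
          using l x(2) by (subst hpoly_radial [OF x(2)]) (simp add: norm_mult)
        also have "\<dots> \<le> l * (sqrt (2 * N) * \<tau>)"
          using l nx x that N by (intro mult_left_mono mult_mono) (auto simp: E_def)
        also have "\<dots> = T * (sqrt (2 * A) / \<epsilon>)"
        proof -
          have "l * sqrt (2 * N) = sqrt (2 * A) * sqrt T"
            using N by (simp add: l_def s_def flip: real_sqrt_mult)
          then have "l * (sqrt (2 * N) * \<tau>) = sqrt (2 * A) * (sqrt T * sqrt T) / \<epsilon>"
            unfolding \<tau>_def times_divide_eq_right mult.assoc [symmetric] by simp
          then show ?thesis using T by simp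
        qed
        also have "\<dots> \<le> T * (A / 8)"
        proof (intro mult_left_mono)
          \<comment> \<open>Squaring \<open>sqrt (2 * A) \<le> \<epsilon> * (A / 8)\<close> gives
            exactly \<open>128 \<le> A * \<epsilon>\<^sup>2\<close>, the source of the constant
            128.\<close>
          have "(sqrt (2 * A))\<^sup>2 \<le> (\<epsilon> * (A / 8))\<^sup>2"
          proof -
            have "128 \<le> A * \<epsilon>\<^sup>2" using A(2) \<epsilon> by (simp add: pos_divide_le_eq)
            then have "A * 128 \<le> A * (A * \<epsilon>\<^sup>2)" using A by (intro mult_left_mono) auto
            then show ?thesis using A by (simp add: power_mult_distrib power_divide power2_eq_square mult_ac)
          qed
          then have "sqrt (2 * A) \<le> \<epsilon> * (A / 8)"
            by (rule power2_le_imp_le) (use A \<epsilon> in simp)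
          then show "sqrt (2 * A) / \<epsilon> \<le> A / 8"
            using \<epsilon> by (simp add: pos_divide_le_eq mult.commute)
        qed (use T in simp)
        also have "\<dots> = s / 8" by (simp add: s_def)
        finally have y: "\<bar>Re (\<Sum>\<alpha>\<in>\<Lambda>. v g \<alpha> * x \<alpha>)\<bar> \<le> s / 8" .
        have "cosh (Re (\<Sum>\<alpha>\<in>\<Lambda>. v g \<alpha> * x \<alpha>)) \<le> exp (s / 8)"
          using y by (rule cosh_le_exp)
        also have "\<dots> \<le> exp (s / 4) / 2"
        proof -
          \<comment> \<open>The condition \<open>A \<ge> 8\<close> ensures
            \<open>exp (s / 8) \<ge> 2\<close>, so \<open>exp (s / 8)\<close> is at most half of its
            square, which is half the mean.\<close>
          have "8 * 1 \<le> s" unfolding s_def using A T by (intro mult_mono) auto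
          then have "2 \<le> exp (s / 8)"
            using exp_ge_add_one_self [of "s / 8"] by linarith
          then have "exp (s / 8) * 2 \<le> exp (s / 8) * exp (s / 8)"
            by (intro mult_left_mono) auto
          also have "\<dots> = exp (s / 4)" unfolding exp_add [symmetric] by simp
          finally show ?thesis by simp
        qed
        finally show ?thesis .
      qed
      then have "(\<Sum>g\<in>?G. cosh (Re (\<Sum>\<alpha>\<in>\<Lambda>. v g \<alpha> * x \<alpha>))) \<le> (\<Sum>g\<in>?G. exp (s / 4) / 2)"
        by (intro sum_mono)
      then have "(\<Sum>g\<in>?G. cosh (Re (\<Sum>\<alpha>\<in>\<Lambda>. v g \<alpha> * x \<alpha>))) \<le> exp (s / 4) / 2 * real (card ?G)"
        by (simp only: sum_constant mult.commute)
      moreover have "real (card ?G) > 0" using G(3) L by simp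
      ultimately have "(\<Sum>g\<in>?G. cosh (Re (\<Sum>\<alpha>\<in>\<Lambda>. v g \<alpha> * x \<alpha>))) / card ?G \<le> exp (s / 4) / 2"
        by (simp only: pos_divide_le_eq)
      then show ?thesis using x unfolding C_def by blast
    qed simp
  qed

  \<comment> \<open>Monotonicity asks for measurability of the larger set \<open>E\<close>, which is
    given by finitely many measurable conditions.\<close>
  have "P.prob {a \<in> unit_sphere \<Lambda>. bh_quotient m n \<Lambda> a > \<epsilon>} \<le> P.prob E"
    using sub1 E by (intro P.finite_measure_mono) (simp_all add: sphere_prob_def sets_surface_measure)
  also have "\<dots> = G.prob {x \<in> \<Lambda> \<rightarrow>\<^sub>E UNIV. 0 < lp_norm 2 \<Lambda> x \<and> radial \<Lambda> x \<in> E}"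
    unfolding measure_def using sphere_prob_eq_gaussian [OF fin \<Lambda>(2) E] by simp
  also have "\<dots> \<le> G.prob (D \<union> C)"
    using sub2 C D by (intro G.finite_measure_mono) auto
  also have "\<dots> \<le> G.prob D + G.prob C"
    using C D by (intro measure_Un_le) auto
  also have "\<dots> \<le> (2 / exp 1) ^ card \<Lambda> + 4 * B"
    using gaussian_norm_tail [OF fin] PC unfolding D_def by (intro add_mono)
  finally show ?thesis by (simp add: B_def N_def)
qed

section \<open>Equivalence of growing index sets and quotients tending to 0 in measure\<close>

theorem theoremB:
  fixes n :: "nat \<Rightarrow> nat"
    and \<Lambda> :: "nat \<Rightarrow> (nat \<Rightarrow> nat) set"
  assumes "\<And>m. m \<ge> 2 \<Longrightarrow> n m \<ge> 1"
    and "\<And>m. m \<ge> 2 \<Longrightarrow> \<Lambda> m \<noteq> {}"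
    and "\<And>m. m \<ge> 2 \<Longrightarrow> \<Lambda> m \<subseteq> multiindices m (n m)"
  shows "filterlim (\<lambda>m. card (\<Lambda> m)) at_top sequentially \<longleftrightarrow>
    (\<forall>\<epsilon>>0. (\<lambda>m. measure (sphere_prob (\<Lambda> m))
        {a \<in> unit_sphere (\<Lambda> m). bh_quotient m (n m) (\<Lambda> m) a > \<epsilon>}) \<longlonglongrightarrow> 0)"
    (is "?lhs \<longleftrightarrow> (\<forall>\<epsilon>>0. ?p \<epsilon> \<longlonglongrightarrow> 0)")
proof (intro iffI allI impI)
  fix \<epsilon> :: real
  assume lhs: ?lhs and \<epsilon>: "\<epsilon> > 0"
  \<comment> \<open>\<open>A\<close> depends on \<open>\<epsilon>\<close> alone, so its smallness
    condition against \<open>(1 / 2) ^ (m - 2)\<close> holds for all large \<open>m\<close>.\<close>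
  define A where "A = max 8 (128 / \<epsilon>\<^sup>2)"
  have A: "A \<ge> 8" "A \<ge> 128 / \<epsilon>\<^sup>2" by (auto simp: A_def)
  have half: "(\<lambda>m. (1 / 2 :: real) ^ (m - 2)) \<longlonglongrightarrow> 0"
    \<comment> \<open>Shifting by 2 removes the truncated subtraction \<open>m - 2\<close>.\<close>
    by (rule LIMSEQ_offset [of _ 2]) (simp add: LIMSEQ_power_zero)
  have card: "filterlim (\<lambda>m. real (card (\<Lambda> m))) at_top sequentially"
    using lhs by (rule filterlim_compose [OF filterlim_real_sequentially])
  show "?p \<epsilon> \<longlonglongrightarrow> 0"
  proof (rule tendsto_sandwich)
    show "eventually (\<lambda>m. 0 \<le> ?p \<epsilon> m) sequentially" by simp
    show "(\<lambda>m. 0 :: real) \<longlonglongrightarrow> 0" by simp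
    have "(\<lambda>m. A\<^sup>2 * exp (2 * A) * (1 / 2) ^ (m - 2)) \<longlonglongrightarrow> A\<^sup>2 * exp (2 * A) * 0"
      by (intro tendsto_intros half)
    then have "eventually (\<lambda>m. A\<^sup>2 * exp (2 * A) * (1 / 2) ^ (m - 2) < 1 / 2) sequentially"
      by (rule order_tendstoD) simp
    then show "eventually (\<lambda>m. ?p \<epsilon> m \<le> (2 / exp 1) ^ card (\<Lambda> m)
        + 4 * (A\<^sup>2 * exp (2 * A) * (1 / card (\<Lambda> m) + 2 * (1 / 2) ^ (m - 2)))) sequentially"
      using eventually_ge_at_top [of 2]
      by eventually_elim (use sphere_prob_bh_quotient_le assms \<epsilon> A in force)
    have "(\<lambda>m. (2 / exp 1 :: real) ^ card (\<Lambda> m)) \<longlonglongrightarrow> 0"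
    proof (rule filterlim_compose [OF _ lhs])
      have "2 < exp (1 :: real)"
        using exp_lower_Taylor_quadratic [of "1 :: real"] by simp
      then show "(\<lambda>k. (2 / exp 1 :: real) ^ k) \<longlonglongrightarrow> 0"
        by (intro LIMSEQ_power_zero) simp
    qed
    moreover have "(\<lambda>m. 1 / real (card (\<Lambda> m))) \<longlonglongrightarrow> 0"
      using tendsto_inverse_0_at_top [OF card] by (simp add: divide_inverse)
    ultimately have "(\<lambda>m. (2 / exp 1) ^ card (\<Lambda> m)
        + 4 * (A\<^sup>2 * exp (2 * A) * (1 / card (\<Lambda> m) + 2 * (1 / 2) ^ (m - 2))))
      \<longlonglongrightarrow> 0 + 4 * (A\<^sup>2 * exp (2 * A) * (0 + 2 * 0))"
      by (intro tendsto_add tendsto_mult tendsto_const half)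
    then show "(\<lambda>m. (2 / exp 1) ^ card (\<Lambda> m)
        + 4 * (A\<^sup>2 * exp (2 * A) * (1 / card (\<Lambda> m) + 2 * (1 / 2) ^ (m - 2)))) \<longlonglongrightarrow> 0"
      by simp
  qed
next
  assume rhs: "\<forall>\<epsilon>>0. ?p \<epsilon> \<longlonglongrightarrow> 0"
  show ?lhs
    unfolding filterlim_at_top
  proof
    fix Z :: nat
    \<comment> \<open>Strictly below \<open>1 / card (\<Lambda> m)\<close> whenever
      \<open>card (\<Lambda> m) < Z\<close>.\<close>
    define \<epsilon> where "\<epsilon> = 1 / (2 * (real Z + 1))"
    have "\<epsilon> > 0" by (simp add: \<epsilon>_def)
    with rhs have "?p \<epsilon> \<longlonglongrightarrow> 0" by blast
    then have "eventually (\<lambda>m. ?p \<epsilon> m < 1) sequentially"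
      by (rule order_tendstoD) simp
    then show "eventually (\<lambda>m. Z \<le> card (\<Lambda> m)) sequentially"
      using eventually_ge_at_top [of 2]
    proof eventually_elim
      case (elim m)
      show "Z \<le> card (\<Lambda> m)"
      proof (rule ccontr)
        assume Z: "\<not> Z \<le> card (\<Lambda> m)"
        have fin: "finite (\<Lambda> m)"
          using assms(3) elim finite_multiindices finite_subset by blast
        interpret P: prob_space "sphere_prob (\<Lambda> m)"
          using fin assms(2) elim by (intro prob_space_sphere_prob) auto
        have c: "card (\<Lambda> m) > 0" using fin assms(2) elim by (simp add: card_gt_0_iff)
        have "\<epsilon> < 1 / card (\<Lambda> m)"
          unfolding \<epsilon>_def using c Z by (intro divide_strict_left_mono) auto
        \<comment> \<open>The lower bound on the quotient makes the event the whole sphere, of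
          probability 1, whereas it was chosen to have probability below 1.\<close>
        then have "bh_quotient m (n m) (\<Lambda> m) a > \<epsilon>" if "a \<in> unit_sphere (\<Lambda> m)" for a
          using bh_quotient_ge [of m "\<Lambda> m" "n m" a] assms elim that by force
        then have "{a \<in> unit_sphere (\<Lambda> m). bh_quotient m (n m) (\<Lambda> m) a > \<epsilon>} = space (sphere_prob (\<Lambda> m))"
          by (auto simp: sphere_prob_def space_surface_measure)
        then show False
          using elim P.prob_space by simp
      qed
    qed
  qed
qed

end
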